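(* Let $\mathcal{D}$ be the generating class of a decomposable model for $I_1\times\cdots\times I_m$ contingency tables with $|\mathcal{D}|\ge2$, and let $\mathcal{T}$ be a clique tree of $\mathcal{G}^{\mathcal{D}}$. Then $\mathcal{M}^{\mathcal{T}}$ is a minimal $G_{I_1,\dots,I_m}$-invariant Markov basis if and only if $\mathcal{T}$ has only two endpoints.
   Context: Let $\Delta=\{1,\dots,m\}$ be the set of variables; variable $\delta$ has level set $\mathcal{I}_\delta=\{0,1,\dots,I_\delta-1\}$ with $I_\delta\ge2$, and the cells are $i=(i_1,\dots,i_m)\in\mathcal{I}=\prod_{\delta\in\Delta}\mathcal{I}_\delta$. A contingency table is a nonnegative integer array $\mathbf{n}=\{n(i)\}_{i\in\mathcal{I}}$. For $D\subset\Delta$, the $D$-marginal table has entries $n_D(i_D)=\sum_{i_{D^C}}n(i_D,i_{D^C})$. The generating class $\mathcal{D}=\{D_1,\dots,D_r\}$ is the set of facets of a simplicial complex with $\bigcup_jD_j=\Delta$. The independence graph $\mathcal{G}^{\mathcal{D}}$ has vertex set $\Delta$, with distinct $\delta,\delta'$ adjacent iff $\delta,\delta'\in D$ for some $D\in\mathcal{D}$. The model is decomposable if $\mathcal{D}$ is the set of maximal cliques of $\mathcal{G}^{\mathcal{D}}$ and $\mathcal{G}^{\mathcal{D}}$ is chordal (every cycle of length greater than three has a chord). A clique tree of $\mathcal{G}^{\mathcal{D}}$ is a tree $\mathcal{T}=(\mathcal{D},\mathcal{E})$ with vertex set $\mathcal{D}$ such that $D_s\cap D_t\subset D_u$ for every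 $D_u$ on the path between $D_s$ and $D_t$ in $\mathcal{T}$ (also when $\mathcal{G}^{\mathcal{D}}$ is disconnected; empty intersections of neighbouring cliques are allowed). Endpoints of $\mathcal{T}$ are its leaves (vertices of degree one). The marginal frequencies of $\mathbf{n}$ are $\mathbf{b}=A\mathbf{n}$, the collection of all entries of the $D_j$-marginal tables, $j=1,\dots,r$; the fiber is $\mathcal{F}_{\mathbf{b}}=\{\mathbf{n}\ge 0\mid A\mathbf{n}=\mathbf{b}\}$. A move for $\mathcal{D}$ is an integer array $\mathbf{z}=\{z(i)\}_{i\in\mathcal{I}}$ with $A\mathbf{z}=\mathbf{0}$, i.e. all its $D$-marginals, $D\in\mathcal{D}$, vanish. A primitive move is a square-free move of degree two, i.e. a move with exactly two entries $+1$, exactly two entries $-1$ and all others $0$. Moves are considered up to sign ($\mathbf{z}$ is identified with $-\mathbf{z}$). A finite set $\mathcal{M}$ of moves is a Markov basis if for every fiber $\mathcal{F}_{\mathbf{b}}$, any two elements of $\mathcal{F}_{\mathbf{b}}$ can be joined by a finite sequence of elements of $\mathcal{F}_{\mathbf{b}}$ in which consecutive tables differ by $\pm\mathbf{z}$ with $\mathbf{z}\in\mathcal{M}$. The group $G=G_{I_1,\dots,I_m}=S_{I_1}\times\cdots\times S_{I_m}$ acts on cells by permuting the levels of each variable, and hence on tables and moves. A set $\mathcal{M}$ of moves is $G$-invariant if $g\in G$, $\mathbf{z}\in\mathcal{M}$ imply $g(\mathbf{z})\in\mathcal{M}$ or $-g(\mathbf{z})\in\mathcal{M}$. A $G$-invariant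 Markov basis is minimal if no proper $G$-invariant subset of it is a Markov basis. For an edge $e\in\mathcal{E}$ of $\mathcal{T}$, let $\mathcal{T}_e=(\mathcal{D}_e,\mathcal{E}_e)$ and $\mathcal{T}'_e=(\mathcal{D}'_e,\mathcal{E}'_e)$ be the two subtrees obtained by removing $e$, and put $V_e=\bigcup_{D\in\mathcal{D}_e}D$, $V'_e=\bigcup_{D\in\mathcal{D}'_e}D$. Let $\mathcal{M}^{\mathcal{T}}(V_e,V'_e)$ be the set of all primitive moves for the decomposable model with generating class $\{V_e,V'_e\}$. Then $\mathcal{M}^{\mathcal{T}}=\bigcup_{e\in\mathcal{E}}\mathcal{M}^{\mathcal{T}}(V_e,V'_e)$ (which is known, by Dobra, to be a Markov basis for $\mathcal{D}$). *)

theory Defs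
  imports Main "HOL-Library.FuncSet" "HOL-Combinatorics.Permutations"
begin

definition simple_graph :: "'v set \<Rightarrow> 'v set set \<Rightarrow> bool" where
  "simple_graph V E \<longleftrightarrow> (\<forall>e\<in>E. \<exists>u\<in>V. \<exists>v\<in>V. u \<noteq> v \<and> e = {u, v})"

definition is_path :: "'v set \<Rightarrow> 'v set set \<Rightarrow> 'v list \<Rightarrow> bool" where
  "is_path V E p \<longleftrightarrow> p \<noteq> [] \<and> set p \<subseteq> V \<and> distinct p \<and> successively (\<lambda>u v. {u, v} \<in> E) p"

definition is_cycle :: "'v set \<Rightarrow> 'v set set \<Rightarrow> 'v list \<Rightarrow> bool" where
  "is_cycle V E c \<longleftrightarrow> 3 \<le> length c \<and> is_path V E c \<and> {last c, hd c} \<in> E"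

definition has_chord :: "'v set set \<Rightarrow> 'v list \<Rightarrow> bool" where
  "has_chord E c \<longleftrightarrow>
     (\<exists>i j. i < j \<and> j < length c \<and> j \<noteq> Suc i \<and> \<not> (i = 0 \<and> j = length c - 1)
            \<and> {c ! i, c ! j} \<in> E)"

definition chordal :: "'v set \<Rightarrow> 'v set set \<Rightarrow> bool" where
  "chordal V E \<longleftrightarrow> (\<forall>c. is_cycle V E c \<and> 3 < length c \<longrightarrow> has_chord E c)"

definition clique :: "'v set \<Rightarrow> 'v set set \<Rightarrow> 'v set \<Rightarrow> bool" where
  "clique V E C \<longleftrightarrow> C \<subseteq> V \<and> (\<forall>u\<in>C. \<forall>v\<in>C. u \<noteq> v \<longrightarrow> {u, v} \<in> E)"

definition maximal_cliques :: "'v set \<Rightarrow> 'v set set \<Rightarrow> 'v set set" where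
  "maximal_cliques V E = {C. clique V E C \<and> (\<forall>C'. clique V E C' \<and> C \<subseteq> C' \<longrightarrow> C' = C)}"

definition reachable :: "'v set set \<Rightarrow> 'v \<Rightarrow> 'v \<Rightarrow> bool" where
  "reachable E = (\<lambda>u v. {u, v} \<in> E)\<^sup>*\<^sup>*"

definition components :: "'v set \<Rightarrow> 'v set set \<Rightarrow> 'v set set" where
  "components V E = (\<lambda>u. {v \<in> V. reachable E u v}) ` V"

definition tree :: "'v set \<Rightarrow> 'v set set \<Rightarrow> bool" where
  "tree V E \<longleftrightarrow> simple_graph V E \<and> V \<noteq> {} \<and>
     (\<forall>u\<in>V. \<forall>v\<in>V. reachable E u v) \<and> (\<nexists>c. is_cycle V E c)"

definition endpoints :: "'v set \<Rightarrow> 'v set set \<Rightarrow> 'v set" where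
  "endpoints V E = {v \<in> V. card {e \<in> E. v \<in> e} = 1}"

definition simplicial_complex :: "'v set \<Rightarrow> 'v set set \<Rightarrow> bool" where
  "simplicial_complex V K \<longleftrightarrow> K \<subseteq> Pow V \<and> (\<forall>F\<in>K. \<forall>F'. F' \<subseteq> F \<longrightarrow> F' \<in> K)"

definition facets :: "'v set set \<Rightarrow> 'v set set" where
  "facets K = {F \<in> K. \<forall>F'\<in>K. F \<subseteq> F' \<longrightarrow> F' = F}"

definition generating_class :: "'v set \<Rightarrow> 'v set set \<Rightarrow> bool" where
  "generating_class V \<D> \<longleftrightarrow> (\<exists>K. simplicial_complex V K \<and> \<D> = facets K) \<and> \<Union>\<D> = V"

definition independence_edges :: "'v set set \<Rightarrow> 'v set set" where
  "independence_edges \<D> = {{u, v} |u v. u \<noteq> v \<and> (\<exists>D\<in>\<D>. u \<in> D \<and> v \<in> D)}"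

definition decomposable :: "'v set \<Rightarrow> 'v set set \<Rightarrow> bool" where
  "decomposable V \<D> \<longleftrightarrow>
     \<D> = maximal_cliques V (independence_edges \<D>) \<and> chordal V (independence_edges \<D>)"

definition clique_tree :: "'v set set \<Rightarrow> 'v set set set \<Rightarrow> bool" where
  "clique_tree \<D> \<E> \<longleftrightarrow> tree \<D> \<E> \<and>
     (\<forall>p. is_path \<D> \<E> p \<longrightarrow> (\<forall>D\<in>set p. hd p \<inter> last p \<subseteq> D))"

text \<open>\<open>V\<close> is the set of variables and \<open>I \<delta>\<close> the number of levels of the variable \<open>\<delta>\<close>.
  Arrays indexed by the cells are total functions that vanish outside the set of cells, so that
  equality of arrays is equality of functions.\<close>

definition cells :: "'v set \<Rightarrow> ('v \<Rightarrow> nat) \<Rightarrow> ('v \<Rightarrow> nat) set" where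
  "cells V I = (\<Pi>\<^sub>E \<delta>\<in>V. {0..<I \<delta>})"

definition arrays :: "'v set \<Rightarrow> ('v \<Rightarrow> nat) \<Rightarrow> (('v \<Rightarrow> nat) \<Rightarrow> int) set" where
  "arrays V I = {z. \<forall>i. i \<notin> cells V I \<longrightarrow> z i = 0}"

definition tables :: "'v set \<Rightarrow> ('v \<Rightarrow> nat) \<Rightarrow> (('v \<Rightarrow> nat) \<Rightarrow> int) set" where
  "tables V I = {n \<in> arrays V I. \<forall>i. 0 \<le> n i}"

definition marginal ::
  "'v set \<Rightarrow> ('v \<Rightarrow> nat) \<Rightarrow> (('v \<Rightarrow> nat) \<Rightarrow> int) \<Rightarrow> 'v set \<Rightarrow> ('v \<Rightarrow> nat) \<Rightarrow> int" where
  "marginal V I z D j = (\<Sum>i \<in> {i \<in> cells V I. restrict i D = j}. z i)"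

definition fiber ::
  "'v set \<Rightarrow> ('v \<Rightarrow> nat) \<Rightarrow> 'v set set \<Rightarrow> ('v set \<Rightarrow> ('v \<Rightarrow> nat) \<Rightarrow> int)
    \<Rightarrow> (('v \<Rightarrow> nat) \<Rightarrow> int) set" where
  "fiber V I \<D> b = {n \<in> tables V I. \<forall>D\<in>\<D>. \<forall>j\<in>cells D I. marginal V I n D j = b D j}"

definition moves ::
  "'v set \<Rightarrow> ('v \<Rightarrow> nat) \<Rightarrow> 'v set set \<Rightarrow> (('v \<Rightarrow> nat) \<Rightarrow> int) set" where
  "moves V I \<D> = {z \<in> arrays V I. \<forall>D\<in>\<D>. \<forall>j\<in>cells D I. marginal V I z D j = 0}"

definition primitive_moves ::
  "'v set \<Rightarrow> ('v \<Rightarrow> nat) \<Rightarrow> 'v set set \<Rightarrow> (('v \<Rightarrow> nat) \<Rightarrow> int) set" where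
  "primitive_moves V I \<D> = {z \<in> moves V I \<D>.
     card {i \<in> cells V I. z i = 1} = 2 \<and> card {i \<in> cells V I. z i = -1} = 2 \<and>
     (\<forall>i \<in> cells V I. z i \<in> {-1, 0, 1})}"

definition markov_basis ::
  "'v set \<Rightarrow> ('v \<Rightarrow> nat) \<Rightarrow> 'v set set \<Rightarrow> (('v \<Rightarrow> nat) \<Rightarrow> int) set \<Rightarrow> bool" where
  "markov_basis V I \<D> M \<longleftrightarrow> finite M \<and> M \<subseteq> moves V I \<D> \<and>
     (\<forall>b. \<forall>n\<in>fiber V I \<D> b. \<forall>n'\<in>fiber V I \<D> b.
        (\<lambda>x y. x \<in> fiber V I \<D> b \<and> y \<in> fiber V I \<D> b \<and>
               (\<exists>z\<in>M. y - x = z \<or> y - x = - z))\<^sup>*\<^sup>* n n')"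

definition level_perms :: "'v set \<Rightarrow> ('v \<Rightarrow> nat) \<Rightarrow> ('v \<Rightarrow> nat \<Rightarrow> nat) set" where
  "level_perms V I = {g. \<forall>\<delta>\<in>V. g \<delta> permutes {0..<I \<delta>}}"

definition act ::
  "'v set \<Rightarrow> ('v \<Rightarrow> nat) \<Rightarrow> ('v \<Rightarrow> nat \<Rightarrow> nat) \<Rightarrow> (('v \<Rightarrow> nat) \<Rightarrow> int) \<Rightarrow> ('v \<Rightarrow> nat) \<Rightarrow> int" where
  "act V I g z = (\<lambda>i. if i \<in> cells V I then z (\<lambda>\<delta>\<in>V. inv (g \<delta>) (i \<delta>)) else 0)"

definition G_invariant :: "'v set \<Rightarrow> ('v \<Rightarrow> nat) \<Rightarrow> (('v \<Rightarrow> nat) \<Rightarrow> int) set \<Rightarrow> bool" where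
  "G_invariant V I M \<longleftrightarrow>
     (\<forall>g\<in>level_perms V I. \<forall>z\<in>M. act V I g z \<in> M \<or> - act V I g z \<in> M)"

text \<open>Moves are identified with their negatives, so a subset is proper only if it misses some
  element together with its negative. With plain proper inclusion, a set containing both \<open>z\<close>
  and \<open>-z\<close> could always be reduced.\<close>

definition proper_subset_upto_sign ::
  "(('v \<Rightarrow> nat) \<Rightarrow> int) set \<Rightarrow> (('v \<Rightarrow> nat) \<Rightarrow> int) set \<Rightarrow> bool" where
  "proper_subset_upto_sign M' M \<longleftrightarrow> M' \<subseteq> M \<and> (\<exists>z\<in>M. z \<notin> M' \<and> - z \<notin> M')"

definition minimal_G_invariant_markov_basis ::
  "'v set \<Rightarrow> ('v \<Rightarrow> nat) \<Rightarrow> 'v set set \<Rightarrow> (('v \<Rightarrow> nat) \<Rightarrow> int) set \<Rightarrow> bool" where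
  "minimal_G_invariant_markov_basis V I \<D> M \<longleftrightarrow>
     markov_basis V I \<D> M \<and> G_invariant V I M \<and>
     \<not> (\<exists>M'. proper_subset_upto_sign M' M \<and> G_invariant V I M' \<and> markov_basis V I \<D> M')"

text \<open>Removing the edge \<open>e\<close> from the tree leaves two components, the vertex sets of the two
  subtrees; the image below is the generating class formed by the unions of their cliques.\<close>

definition tree_moves ::
  "'v set \<Rightarrow> ('v \<Rightarrow> nat) \<Rightarrow> 'v set set \<Rightarrow> 'v set set set \<Rightarrow> (('v \<Rightarrow> nat) \<Rightarrow> int) set" where
  "tree_moves V I \<D> \<E> = (\<Union>e\<in>\<E>. primitive_moves V I (Union ` components \<D> (\<E> - {e})))"

end

theory Submission
  imports Defs
begin

text \<open>
  A primitive move for \<open>{A, B}\<close> takes two cells that agree on \<open>A \<inter> B\<close> and exchanges their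
  coordinates in \<open>A\<close>. For an edge \<open>{P, Q}\<close> of the clique tree the two sides overlap exactly in
  \<open>P \<inter> Q\<close>.

  Markov basis: grow a subtree of cliques \<open>X\<close> one edge at a time, keeping the \<open>\<Union>X\<close>-marginals of the
  two tables equal. When \<open>Q\<close> joins \<open>X\<close>, both tables agree on the marginals of \<open>\<Union>X\<close> and \<open>Q\<close>, and
  swaps along the new edge, which preserve both marginals, decrease the \<open>L\<^sub>1\<close>-distance of the marginals
  on \<open>\<Union>X \<union> Q\<close>.

  Two endpoints: the sides containing a fixed endpoint form a chain. Let \<open>z\<close> be a move along the edge
  \<open>e\<close>, exchanging \<open>i\<close> and \<open>i'\<close>, that is missing from an invariant subset. Among the variables where
  \<open>i\<close> and \<open>i'\<close> differ, choose \<open>u\<close> and \<open>w\<close> adjacent to the cut of \<open>e\<close> on its two sides. In the fiber of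
  \<open>i + i'\<close> a move that changes which level at \<open>u\<close> is paired with which level at \<open>w\<close> cuts the differing
  variables as \<open>e\<close> does, so it lies in the orbit of \<open>z\<close> up to sign. Hence this pairing is an
  invariant of the moves in the subset, while \<open>z\<close> changes it.

  Three endpoints: each of three leaves has a vertex that lies in no other clique. If two cells differ
  exactly at these three vertices, then exchanging the first coordinate amounts to exchanging the
  second and then the third, so an orbit is redundant.
\<close>

section \<open>Sides of a tree edge\<close>

lemma reachable_refl: "reachable E u u"
  by (simp add: reachable_def)

lemma reachable_step: "reachable E u v \<Longrightarrow> {v, w} \<in> E \<Longrightarrow> reachable E u w"
  unfolding reachable_def by (rule rtranclp.rtrancl_into_rtrancl)

lemma reachable_trans: "reachable E u v \<Longrightarrow> reachable E v w \<Longrightarrow> reachable E u w"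
  unfolding reachable_def by (rule rtranclp_trans)

lemma reachable_sym: "reachable E u v \<Longrightarrow> reachable E v u"
  unfolding reachable_def
  by (metis (mono_tags, lifting) insert_commute sympI sympD symp_rtranclp)

lemma reachable_induct [consumes 1, case_names refl step]:
  assumes "reachable E u v" and "P u"
    and "\<And>v w. reachable E u v \<Longrightarrow> {v, w} \<in> E \<Longrightarrow> P v \<Longrightarrow> P w"
  shows "P v"
  using assms unfolding reachable_def by (induction rule: rtranclp_induct) blast+

lemma reachable_mono: "reachable E u v \<Longrightarrow> E \<subseteq> E' \<Longrightarrow> reachable E' u v"
  by (induction rule: reachable_induct) (auto intro: reachable_refl reachable_step)

lemma simple_graph_edge:
  assumes "simple_graph V E" and "{u, v} \<in> E"
  shows "u \<in> V" "v \<in> V" "u \<noteq> v"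
  using assms unfolding simple_graph_def by (auto simp: doubleton_eq_iff)

lemma simple_graph_edgeE:
  assumes "simple_graph V E" and "e \<in> E"
  obtains u v where "u \<in> V" "v \<in> V" "u \<noteq> v" "e = {u, v}"
  using assms unfolding simple_graph_def by blast

lemma is_path_prefix: "is_path V E (p @ q) \<Longrightarrow> p \<noteq> [] \<Longrightarrow> is_path V E p"
  unfolding is_path_def by (auto simp: successively_append_iff)

text \<open>Extending a walk by an edge keeps a simple path: if the new vertex already occurs, the
  path is cut off at that vertex.\<close>

lemma reachable_imp_path:
  assumes "reachable E u v" and "u \<in> V" and "\<Union>E \<subseteq> V"
  shows "\<exists>p. is_path V E p \<and> hd p = u \<and> last p = v"
  using assms(1)
proof (induction rule: reachable_induct)
  case refl
  have "is_path V E [u]" using assms by (simp add: is_path_def)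
  then show ?case by force
next
  case (step v w)
  then obtain p where p: "is_path V E p" "hd p = u" "last p = v" by blast
  show ?case
  proof (cases "w \<in> set p")
    case True
    then obtain q r where q: "p = (q @ [w]) @ r" by (metis append.assoc append_Cons append_Nil split_list)
    then have "is_path V E (q @ [w])" using p(1) is_path_prefix by blast
    moreover have "hd (q @ [w]) = u" using p(2) q by (cases q) auto
    ultimately show ?thesis by force
  next
    case False
    have "w \<in> V" using step(2) assms(3) by blast
    then have "is_path V E (p @ [w])" using p False step(2)
      by (auto simp: is_path_def successively_append_iff)
    moreover have "hd (p @ [w]) = u" using p by (auto simp: is_path_def)
    ultimately show ?thesis by force
  qed
qed

text \<open>The base vertex \<open>u\<close> may be any vertex, not just an end of \<open>e\<close>;
  thus one leaf can name a side of every edge at once.\<close>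

definition side :: "'v set \<Rightarrow> 'v set set \<Rightarrow> 'v set \<Rightarrow> 'v \<Rightarrow> 'v set" where
  "side V E e u = {v \<in> V. reachable (E - {e}) u v}"

lemma side_self: "u \<in> V \<Longrightarrow> u \<in> side V E e u"
  by (simp add: side_def reachable_refl)

lemma side_subset: "side V E e u \<subseteq> V"
  by (auto simp: side_def)

lemma side_eq: "w \<in> side V E e u \<Longrightarrow> side V E e w = side V E e u"
  by (auto simp: side_def intro: reachable_trans reachable_sym)

text \<open>A walk avoiding the edge would yield a simple path between its ends, and the edge would
  close that path to a cycle.\<close>

lemma tree_bridge:
  assumes "tree V E" and e: "{u, v} \<in> E"
  shows "\<not> reachable (E - {{u, v}}) u v"
proof
  assume r: "reachable (E - {{u, v}}) u v"
  have g: "simple_graph V E" using assms by (simp add: tree_def)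
  note uv = simple_graph_edge[OF g e]
  have "\<Union>(E - {{u, v}}) \<subseteq> V" using g by (auto simp: simple_graph_def)
  from reachable_imp_path[OF r uv(1) this]
  obtain p where p: "is_path V (E - {{u, v}}) p" "hd p = u" "last p = v" by blast
  then obtain q where q: "p = u # q" "q \<noteq> []"
    using uv(3) by (cases p) (auto simp: is_path_def split: if_splits)
  \<comment> \<open>A path with just two vertices would use the deleted edge itself, so there are at
    least three, as \<open>is_cycle\<close> demands.\<close>
  have "length q \<noteq> 1"
    using p q by (auto simp: is_path_def length_Suc_conv)
  then have "3 \<le> length p" using q by (cases q; cases "tl q") auto
  moreover have "is_path V E p"
    using p(1) unfolding is_path_def by (auto elim: successively_mono)
  moreover have "{last p, hd p} \<in> E" using p e by (simp add: insert_commute)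
  ultimately show False using assms(1) by (auto simp: tree_def is_cycle_def)
qed

context
  fixes V :: "'v set" and E
  assumes tree: "tree V E"
begin

lemma tree_simple: "simple_graph V E" using tree by (simp add: tree_def)

lemma sides_disjoint:
  assumes "{u, v} \<in> E"
  shows "side V E {u, v} u \<inter> side V E {u, v} v = {}"
  using tree_bridge[OF tree assms] by (auto simp: side_def intro: reachable_trans reachable_sym)

text \<open>A walk from \<open>u\<close> is followed edge by edge; each time it uses
  \<open>{u, v}\<close> it stands at \<open>u\<close> or \<open>v\<close> again, the base vertex of
  one of the sides.\<close>

lemma sides_cover:
  assumes e: "{u, v} \<in> E"
  shows "side V E {u, v} u \<union> side V E {u, v} v = V"
proof -
  have "w \<in> side V E {u, v} u \<union> side V E {u, v} v" if "w \<in> V" for w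
  proof -
    have "reachable E u w"
      using tree that simple_graph_edge[OF tree_simple e] by (simp add: tree_def)
    then have "reachable (E - {{u, v}}) u w \<or> reachable (E - {{u, v}}) v w"
    proof (induction rule: reachable_induct)
      case refl
      show ?case by (simp add: reachable_refl)
    next
      case (step x y)
      show ?case
      proof (cases "{x, y} = {u, v}")
        case True
        then show ?thesis by (auto simp: doubleton_eq_iff intro: reachable_refl)
      next
        case False
        then show ?thesis using step by (auto intro: reachable_step)
      qed
    qed
    then show ?thesis using that by (auto simp: side_def)
  qed
  then show ?thesis by (auto simp: side_def)
qed

lemma components_remove_edge:
  assumes e: "{u, v} \<in> E"
  shows "components V (E - {{u, v}}) = {side V E {u, v} u, side V E {u, v} v}"
proof -
  have "components V (E - {{u, v}}) = side V E {u, v} ` V"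
    by (simp add: components_def side_def)
  also have "\<dots> = {side V E {u, v} u, side V E {u, v} v}"
  proof
    show "side V E {u, v} ` V \<subseteq> {side V E {u, v} u, side V E {u, v} v}"
    proof
      fix C assume "C \<in> side V E {u, v} ` V"
      then obtain w where w: "w \<in> V" "C = side V E {u, v} w" by blast
      then have "w \<in> side V E {u, v} u \<or> w \<in> side V E {u, v} v" using sides_cover[OF e] by blast
      then show "C \<in> {side V E {u, v} u, side V E {u, v} v}"
        using side_eq[of w V E] w(2) by auto
    qed
  qed (use simple_graph_edge[OF tree_simple e] in auto)
  finally show ?thesis .
qed

lemma edge_same_side:
  assumes "f \<in> E" "f \<noteq> e" "x \<in> f" "y \<in> f" "x \<in> side V E e u"
  shows "y \<in> side V E e u"
proof (cases "x = y")
  case False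
  obtain p q where pq: "p \<in> V" "q \<in> V" "f = {p, q}"
    using simple_graph_edgeE[OF tree_simple assms(1)] by metis
  have "f = {x, y}" using assms(3,4) False pq(3) by blast
  then have xy: "{x, y} \<in> E - {e}" using assms(1,2) by blast
  have "y \<in> V" using assms(4) pq by blast
  have "reachable (E - {e}) u x" using assms(5) by (simp add: side_def)
  then show ?thesis
    using reachable_step[OF _ xy] \<open>y \<in> V\<close> by (simp add: side_def)
qed (use assms in simp)

section \<open>Endpoints of a tree and the sides containing them\<close>

text \<open>Unless \<open>v\<close> is itself a leaf, another edge at \<open>v\<close> leads to a
  side strictly inside the current one, so the descent ends at a leaf.\<close>

lemma endpoint_in_side:
  assumes fin: "finite V" and e: "{u, v} \<in> E"
  shows "\<exists>l\<in>endpoints V E. l \<in> side V E {u, v} v"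
  using e
proof (induction "card (side V E {u, v} v)" arbitrary: u v rule: less_induct)
  case less
  note uv = simple_graph_edge[OF tree_simple less(2)]
  show ?case
  proof (cases "{e \<in> E. v \<in> e} = {{u, v}}")
    case True
    then show ?thesis using side_self[OF uv(2)] uv by (auto simp: endpoints_def)
  next
    case False
    then obtain f where f: "f \<in> E" "v \<in> f" "f \<noteq> {u, v}" using less(2) by blast
    then obtain x where x: "f = {v, x}" "x \<in> V" "x \<noteq> v"
      using simple_graph_edgeE[OF tree_simple f(1)] f(2) by (metis insertE insert_commute singletonD)
    have vx: "{v, x} \<in> E" using f x by simp
    have nv: "v \<notin> side V E {v, x} x"
      using sides_disjoint[OF vx] side_self[OF uv(2)] by blast
    \<comment> \<open>A walk from \<open>x\<close> avoiding \<open>{v, x}\<close> cannot reach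
      \<open>v\<close>, hence never uses \<open>{u, v}\<close> either.\<close>
    have sub: "side V E {v, x} x \<subseteq> side V E {u, v} v"
    proof
      fix w assume w: "w \<in> side V E {v, x} x"
      then have "reachable (E - {{v, x}}) x w" by (simp add: side_def)
      then have "w \<in> side V E {u, v} v"
      proof (induction rule: reachable_induct)
        case refl
        show ?case using edge_same_side[of f "{u, v}" v x v] f x side_self[OF uv(2)] by auto
      next
        case (step y z)
        have "y \<in> V" "z \<in> V" using simple_graph_edge[OF tree_simple, of y z] step(2) by auto
        then have "y \<noteq> v" "z \<noteq> v"
          using nv step(1) reachable_step[OF step(1,2)] by (auto simp: side_def)
        then have "{y, z} \<noteq> {u, v}" by auto
        then show ?case using edge_same_side[of "{y, z}" "{u, v}" y z v] step by auto
      qed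
      then show "w \<in> side V E {u, v} v" .
    qed
    have "side V E {v, x} x \<subset> side V E {u, v} v"
      using sub nv side_self[OF uv(2)] by blast
    then have "card (side V E {v, x} x) < card (side V E {u, v} v)"
      using fin side_subset by (metis finite_subset psubset_card_mono)
    from less(1)[OF this vx] show ?thesis using sub by blast
  qed
qed

lemma endpoint_edge:
  assumes "a \<in> endpoints V E"
  obtains b where "{a, b} \<in> E" and "side V E {a, b} a = {a}"
proof -
  have a: "a \<in> V" "card {e \<in> E. a \<in> e} = 1" using assms by (auto simp: endpoints_def)
  then obtain e where e: "{e \<in> E. a \<in> e} = {e}" by (auto simp: card_1_singleton_iff)
  then have eE: "e \<in> E" "a \<in> e" by auto
  obtain b where b: "e = {a, b}"
    using simple_graph_edgeE[OF tree_simple eE(1)] eE(2) by (metis insertE insert_commute singletonD)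
  have "w = a" if "reachable (E - {e}) a w" for w
    using that
  proof (induction rule: reachable_induct)
    case (step v w)
    then have "{v, w} \<in> {e \<in> E. a \<in> e}" by blast
    then have "{v, w} = e" unfolding e by simp
    then show ?case using step(2) by simp
  qed simp
  then have "side V E {a, b} a = {a}" using a(1) b unfolding side_def by (auto intro: reachable_refl)
  then show ?thesis using that eE b by blast
qed

text \<open>The two sides of any edge are disjoint, and each contains an endpoint.\<close>

lemma two_le_card_endpoints:
  assumes "finite V" "2 \<le> card V"
  shows "2 \<le> card (endpoints V E)"
proof -
  obtain x y where xy: "x \<in> V" "y \<in> V" "x \<noteq> y"
    using assms(2) by (meson card_2_iff' obtain_subset_with_card_n subsetD)
  have "reachable E x y" using tree xy by (simp add: tree_def)
  then have "E \<noteq> {}" using xy(3)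
    by (auto simp: reachable_def elim: rtranclp.cases)
  then obtain u v where e: "{u, v} \<in> E" using simple_graph_edgeE[OF tree_simple] by blast
  then have e': "{v, u} \<in> E" by (simp add: insert_commute)
  obtain l where l: "l \<in> endpoints V E" "l \<in> side V E {u, v} v"
    using endpoint_in_side[OF assms(1) e] by blast
  obtain l' where l': "l' \<in> endpoints V E" "l' \<in> side V E {u, v} u"
    using endpoint_in_side[OF assms(1) e'] by (auto simp: insert_commute)
  have "l \<noteq> l'" using sides_disjoint[OF e] l l' by blast
  moreover have "finite (endpoints V E)" using assms(1) by (simp add: endpoints_def)
  ultimately show ?thesis using l l' card_mono[of "endpoints V E" "{l, l'}"] by auto
qed

text \<open>Each side of \<open>e\<close> contains an endpoint, so with only two of them each side
  contains exactly one. The sides can therefore be named by \<open>a\<close> and \<open>b\<close>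
  for all edges alike.\<close>

lemma two_endpoints_sides:
  assumes "finite V" and ab: "endpoints V E = {a, b}" and e: "e \<in> E"
  shows "components V (E - {e}) = {side V E e a, side V E e b}"
    "side V E e a \<inter> side V E e b = {}" "side V E e a \<union> side V E e b = V"
proof -
  obtain u v where uv: "e = {u, v}" using simple_graph_edgeE[OF tree_simple e] by blast
  have e1: "{u, v} \<in> E" and e2: "{v, u} \<in> E" using e uv by (auto simp: insert_commute)
  obtain l where l: "l \<in> {a, b}" "l \<in> side V E e v"
    using endpoint_in_side[OF assms(1) e1] ab uv by blast
  obtain l' where l': "l' \<in> {a, b}" "l' \<in> side V E e u"
    using endpoint_in_side[OF assms(1) e2] ab uv by (auto simp: insert_commute)
  have "l \<noteq> l'" using sides_disjoint[OF e1] l l' uv by blast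
  then have "l = a \<and> l' = b \<or> l = b \<and> l' = a" using l l' by blast
  then have "side V E e u = side V E e b \<and> side V E e v = side V E e a \<or>
      side V E e u = side V E e a \<and> side V E e v = side V E e b"
    using side_eq[OF l(2)] side_eq[OF l'(2)] by metis
  then show "components V (E - {e}) = {side V E e a, side V E e b}"
    "side V E e a \<inter> side V E e b = {}" "side V E e a \<union> side V E e b = V"
    using components_remove_edge[OF e1] sides_disjoint[OF e1] sides_cover[OF e1] uv by auto
qed

text \<open>A walk confined to this side of \<open>e\<close> never uses \<open>f\<close>, which lies
  in the disjoint set \<open>B\<close>.\<close>

lemma side_subset_side:
  assumes "f \<in> E" "f \<subseteq> B" "side V E e a \<inter> B = {}"
  shows "side V E e a \<subseteq> side V E f a"
proof
  fix w assume w: "w \<in> side V E e a"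
  then have "reachable (E - {e}) a w" by (simp add: side_def)
  then have "reachable (E - {f}) a w"
  proof (induction rule: reachable_induct)
    case refl
    show ?case by (rule reachable_refl)
  next
    case (step y z)
    have "y \<in> V" using simple_graph_edge[OF tree_simple, of y z] step by auto
    then have "{y, z} \<noteq> f" using step(1) assms by (auto simp: side_def)
    then show ?case using step by (auto intro: reachable_step)
  qed
  then show "w \<in> side V E f a" using w by (simp add: side_def)
qed

text \<open>An edge \<open>f\<close> other than \<open>e\<close> lies wholly on one side of
  \<open>e\<close>. The opposite side of \<open>e\<close> survives the deletion of \<open>f\<close>,
  which gives one inclusion; complements give the other.\<close>

lemma two_endpoints_chain:
  assumes fin: "finite V" and ab: "endpoints V E = {a, b}" and e: "e \<in> E" and f: "f \<in> E"
  shows "side V E e a \<subseteq> side V E f a \<and> side V E f b \<subseteq> side V E e b \<or>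
         side V E f a \<subseteq> side V E e a \<and> side V E e b \<subseteq> side V E f b"
proof (cases "e = f")
  case False
  note e' = two_endpoints_sides[OF fin ab e] and f' = two_endpoints_sides[OF fin ab f]
  obtain p q where pq: "p \<in> V" "q \<in> V" "f = {p, q}"
    using simple_graph_edgeE[OF tree_simple f] by blast
  show ?thesis
  proof (cases "p \<in> side V E e a")
    case True
    then have "f \<subseteq> side V E e a" using edge_same_side[OF f, of e p] False pq by auto
    then have "side V E e b \<subseteq> side V E f b" using side_subset_side[OF f] e'(2) by blast
    moreover from this have "side V E f a \<subseteq> side V E e a" using e'(3) f'(2,3) by blast
    ultimately show ?thesis by simp
  next
    case nin: False
    then have "p \<in> side V E e b" using e'(3) pq by blast
    then have "f \<subseteq> side V E e b" using edge_same_side[OF f, of e p] False pq by auto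
    then have "side V E e a \<subseteq> side V E f a" using side_subset_side[OF f] e'(2) by blast
    moreover from this have "side V E f b \<subseteq> side V E e b" using e'(3) f'(2,3) by blast
    ultimately show ?thesis by simp
  qed
qed simp

end

text \<open>If \<open>x\<close> lies in cliques \<open>D\<close> and \<open>D'\<close> on opposite
  sides, the path from \<open>D\<close> to \<open>D'\<close> runs through \<open>P\<close> and
  \<open>Q\<close>, and the clique tree property puts \<open>x\<close> into both.\<close>

lemma clique_tree_separator:
  assumes ct: "clique_tree \<D> \<E>" and e: "{P, Q} \<in> \<E>"
  shows "\<Union>(side \<D> \<E> {P, Q} P) \<inter> \<Union>(side \<D> \<E> {P, Q} Q) = P \<inter> Q"
proof
  have tr: "tree \<D> \<E>" using ct by (simp add: clique_tree_def)
  note g = tree_simple[OF tr]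
  note PQ = simple_graph_edge[OF g e]
  show "P \<inter> Q \<subseteq> \<Union>(side \<D> \<E> {P, Q} P) \<inter> \<Union>(side \<D> \<E> {P, Q} Q)"
    using side_self[OF PQ(1), of \<E> "{P, Q}"] side_self[OF PQ(2), of \<E> "{P, Q}"] by blast
  show "\<Union>(side \<D> \<E> {P, Q} P) \<inter> \<Union>(side \<D> \<E> {P, Q} Q) \<subseteq> P \<inter> Q"
  proof
    fix x assume "x \<in> \<Union>(side \<D> \<E> {P, Q} P) \<inter> \<Union>(side \<D> \<E> {P, Q} Q)"
    then obtain D D' where D: "D \<in> side \<D> \<E> {P, Q} P" "x \<in> D"
      and D': "D' \<in> side \<D> \<E> {P, Q} Q" "x \<in> D'" by blast
    let ?E = "\<E> - {{P, Q}}"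
    let ?A = "side \<D> \<E> {P, Q} P" and ?B = "side \<D> \<E> {P, Q} Q"
    \<comment> \<open>The path is sought in the graph induced on one side. Paths for the two sides
      are then disjoint, and joining them over \<open>{P, Q}\<close> gives a simple path.\<close>
    have path_in: "\<exists>p. is_path \<D> \<E> p \<and> set p \<subseteq> side \<D> \<E> {P, Q} R \<and> hd p = R \<and> last p = C"
      if R: "R \<in> \<D>" and C: "C \<in> side \<D> \<E> {P, Q} R" for R C
    proof -
      let ?S = "side \<D> \<E> {P, Q} R"
      have "reachable ?E R C" using C by (simp add: side_def)
      then have "reachable {f \<in> ?E. f \<subseteq> ?S} R C"
      proof (induction rule: reachable_induct)
        case refl
        show ?case by (rule reachable_refl)
      next
        case (step y z)
        have "y \<in> \<D>" "z \<in> \<D>" using simple_graph_edge[OF g, of y z] step by auto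
        then have "{y, z} \<subseteq> ?S" using step(1) reachable_step[OF step(1,2)] by (simp add: side_def)
        then show ?case using step(2,3) by (blast intro: reachable_step)
      qed
      from reachable_imp_path[OF this side_self[OF R]]
      obtain p where p: "is_path ?S {f \<in> ?E. f \<subseteq> ?S} p" "hd p = R" "last p = C" by blast
      then have "is_path \<D> \<E> p" using side_subset[of \<D> \<E> "{P, Q}" R]
        unfolding is_path_def by (auto elim: successively_mono)
      then show ?thesis using p by (auto simp: is_path_def)
    qed
    obtain p where p: "is_path \<D> \<E> p" "set p \<subseteq> ?A" "hd p = P" "last p = D"
      using path_in[OF PQ(1) D(1)] by blast
    obtain q where q: "is_path \<D> \<E> q" "set q \<subseteq> ?B" "hd q = Q" "last q = D'"
      using path_in[OF PQ(2) D'(1)] by blast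
    have ne: "p \<noteq> []" "q \<noteq> []" using p(1) q(1) by (auto simp: is_path_def)
    have "set p \<inter> set q = {}" using p q sides_disjoint[OF tr e] by blast
    then have "is_path \<D> \<E> (rev p @ q)"
      using p(1,3) q(1,3) e ne
      by (auto simp: is_path_def successively_append_iff last_rev successively_rev insert_commute)
    then have "\<forall>C\<in>set (rev p @ q). hd (rev p @ q) \<inter> last (rev p @ q) \<subseteq> C"
      using ct unfolding clique_tree_def by blast
    moreover have "hd (rev p @ q) = D" "last (rev p @ q) = D'"
      using p q ne by (auto simp: hd_rev)
    moreover have "P \<in> set (rev p @ q)" "Q \<in> set (rev p @ q)"
      using p q ne hd_in_set by fastforce+
    ultimately show "x \<in> P \<inter> Q" using D D' by blast
  qed
qed

section \<open>Primitive moves as swaps\<close>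

lemma cells_iff: "i \<in> cells V I \<longleftrightarrow> (\<forall>\<delta>\<in>V. i \<delta> < I \<delta>) \<and> (\<forall>\<delta>. \<delta> \<notin> V \<longrightarrow> i \<delta> = undefined)"
  by (auto simp: cells_def PiE_iff extensional_def)

lemma finite_cells: "finite V \<Longrightarrow> finite (cells V I)"
  by (simp add: cells_def finite_PiE)

lemma restrict_eq_iff: "restrict i D = restrict j D \<longleftrightarrow> (\<forall>\<delta>\<in>D. i \<delta> = j \<delta>)"
  by (metis restrict_apply' restrict_ext)

lemma restrict_in_cells: "i \<in> cells V I \<Longrightarrow> D \<subseteq> V \<Longrightarrow> restrict i D \<in> cells D I"
  by (auto simp: cells_iff)

lemma restrict_cell: "i \<in> cells V I \<Longrightarrow> restrict i V = i"
  by (simp add: cells_def PiE_def extensional_restrict)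

lemma cells_eqI: "i \<in> cells V I \<Longrightarrow> j \<in> cells V I \<Longrightarrow> (\<And>\<delta>. \<delta> \<in> V \<Longrightarrow> i \<delta> = j \<delta>) \<Longrightarrow> i = j"
  unfolding cells_def by (rule PiE_ext)

definition mix :: "'v set \<Rightarrow> ('v \<Rightarrow> nat) \<Rightarrow> ('v \<Rightarrow> nat) \<Rightarrow> 'v \<Rightarrow> nat" where
  "mix A i i' = (\<lambda>\<delta>. if \<delta> \<in> A then i' \<delta> else i \<delta>)"

lemma mix_in_cells: "i \<in> cells V I \<Longrightarrow> i' \<in> cells V I \<Longrightarrow> mix A i i' \<in> cells V I"
  by (auto simp: cells_iff mix_def)

lemma mix_mix: "mix A (mix A i i') (mix A i' i) = i"
  by (auto simp: mix_def)

text \<open>Subtracting \<open>swap A i i'\<close> from a table lets one unit in \<open>i\<close> and one in \<open>i'\<close> exchange their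
  coordinates in \<open>A\<close>.\<close>

definition swap :: "'v set \<Rightarrow> ('v \<Rightarrow> nat) \<Rightarrow> ('v \<Rightarrow> nat) \<Rightarrow> ('v \<Rightarrow> nat) \<Rightarrow> int" where
  "swap A i i' = (\<lambda>c. of_bool (c = i) + of_bool (c = i') - of_bool (c = mix A i i')
     - of_bool (c = mix A i' i))"

text \<open>The exchange is an involution on pairs of cells, so the reverse move is again a swap and
  signs can be absorbed.\<close>

lemma uminus_swap: "- swap A i i' = swap A (mix A i i') (mix A i' i)"
  by (auto simp: swap_def mix_mix fun_eq_iff)

lemma swap_commute: "swap A i i' = swap A i' i"
  by (auto simp: swap_def fun_eq_iff)

lemma mix_cong:
  "(\<And>\<delta>. i \<delta> \<noteq> i' \<delta> \<Longrightarrow> \<delta> \<in> A \<longleftrightarrow> \<delta> \<in> B) \<Longrightarrow> mix A i i' = mix B i i'"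
  unfolding mix_def by (rule ext) metis

text \<open>Only the coordinates in which the cells differ matter. Moves along different edges
  coincide when their cuts agree there.\<close>

lemma swap_cong:
  assumes "\<And>\<delta>. i \<delta> \<noteq> i' \<delta> \<Longrightarrow> \<delta> \<in> A \<longleftrightarrow> \<delta> \<in> B"
  shows "swap A i i' = swap B i i'"
proof -
  have "mix A i i' = mix B i i'" using assms by (rule mix_cong)
  moreover have "mix A i' i = mix B i' i" using assms by (intro mix_cong) metis
  ultimately show ?thesis by (simp add: swap_def)
qed

section \<open>Marginals of swaps, and primitive moves for two generators\<close>

lemma marginal_add:
  "finite V \<Longrightarrow> marginal V I (\<lambda>c. f c + g c) D j = marginal V I f D j + marginal V I g D j"
  by (simp add: marginal_def sum.distrib)

lemma marginal_diff:
  "finite V \<Longrightarrow> marginal V I (\<lambda>c. f c - g c) D j = marginal V I f D j - marginal V I g D j"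
  by (simp add: marginal_def sum_subtractf)

lemma marginal_of_bool:
  assumes "finite V" "i \<in> cells V I"
  shows "marginal V I (\<lambda>c. of_bool (c = i)) D j = of_bool (restrict i D = j)"
  using assms by (simp add: marginal_def of_bool_def finite_cells sum.delta)

lemma marginal_four:
  assumes "finite V" "a \<in> cells V I" "b \<in> cells V I" "c \<in> cells V I" "d \<in> cells V I"
  shows "marginal V I (\<lambda>k. of_bool (k = a) + of_bool (k = b) - of_bool (k = c) - of_bool (k = d)) D j =
     of_bool (restrict a D = j) + of_bool (restrict b D = j) - of_bool (restrict c D = j)
       - of_bool (restrict d D = j)"
  using assms by (simp add: marginal_add marginal_diff marginal_of_bool)

lemma marginal_swap:
  assumes "finite V" "i \<in> cells V I" "i' \<in> cells V I"
  shows "marginal V I (swap A i i') D j = of_bool (restrict i D = j) + of_bool (restrict i' D = j)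
     - of_bool (restrict (mix A i i') D = j) - of_bool (restrict (mix A i' i) D = j)"
  unfolding swap_def using assms by (intro marginal_four mix_in_cells)

text \<open>On \<open>D \<subseteq> A\<close> the two cells trade their restrictions; on
  \<open>D \<subseteq> B\<close> nothing changes, because they agree on the overlap.\<close>

lemma marginal_swap_zero:
  assumes "finite V" "i \<in> cells V I" "i' \<in> cells V I" and eq: "\<forall>\<delta>\<in>A \<inter> B. i \<delta> = i' \<delta>"
    and "D \<subseteq> A \<or> D \<subseteq> B"
  shows "marginal V I (swap A i i') D j = 0"
  using assms(5)
proof
  assume D: "D \<subseteq> A"
  have "restrict (mix A i i') D = restrict i' D" "restrict (mix A i' i) D = restrict i D"
    unfolding restrict_eq_iff using D by (auto simp: mix_def)
  then show ?thesis using assms(1-3) by (simp add: marginal_swap)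
next
  assume D: "D \<subseteq> B"
  have "restrict (mix A i i') D = restrict i D" "restrict (mix A i' i) D = restrict i' D"
    unfolding restrict_eq_iff using D eq by (auto simp: mix_def)
  then show ?thesis using assms(1-3) by (simp add: marginal_swap)
qed

lemma swap_arrays: "i \<in> cells V I \<Longrightarrow> i' \<in> cells V I \<Longrightarrow> swap A i i' \<in> arrays V I"
  using mix_in_cells[of i V I i' A] mix_in_cells[of i' V I i A]
  by (auto simp: arrays_def swap_def)

text \<open>Without a difference both inside and outside \<open>A\<close> the swap would be the zero
  array; with both, the four cells are distinct.\<close>

lemma swap_apply:
  assumes A: "\<delta>\<^sub>1 \<in> A" "i \<delta>\<^sub>1 \<noteq> i' \<delta>\<^sub>1" and B: "\<delta>\<^sub>2 \<notin> A" "i \<delta>\<^sub>2 \<noteq> i' \<delta>\<^sub>2"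
  shows "swap A i i' c = (if c \<in> {i, i'} then 1 else if c \<in> {mix A i i', mix A i' i} then -1 else 0)"
    and "{i, i'} \<inter> {mix A i i', mix A i' i} = {}" and "mix A i i' \<noteq> mix A i' i"
proof -
  let ?j = "mix A i i'" and ?j' = "mix A i' i"
  have d: "?j \<delta>\<^sub>1 = i' \<delta>\<^sub>1" "?j' \<delta>\<^sub>1 = i \<delta>\<^sub>1" "?j \<delta>\<^sub>2 = i \<delta>\<^sub>2" "?j' \<delta>\<^sub>2 = i' \<delta>\<^sub>2"
    using A(1) B(1) by (auto simp: mix_def)
  have "i \<noteq> ?j" "i \<noteq> ?j'" "i' \<noteq> ?j" "i' \<noteq> ?j'" and "i \<noteq> i'" and jj: "?j \<noteq> ?j'"
    using d A(2) B(2) by metis+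
  then show "swap A i i' c = (if c \<in> {i, i'} then 1 else if c \<in> {?j, ?j'} then -1 else 0)"
    and "{i, i'} \<inter> {?j, ?j'} = {}"
    by (auto simp: swap_def)
  show "?j \<noteq> ?j'" by (rule jj)
qed

lemma swap_primitive:
  assumes V: "finite V" and i: "i \<in> cells V I" "i' \<in> cells V I"
    and eq: "\<forall>\<delta>\<in>A \<inter> B. i \<delta> = i' \<delta>"
    and A: "\<delta>\<^sub>1 \<in> A - B" "i \<delta>\<^sub>1 \<noteq> i' \<delta>\<^sub>1" and B: "\<delta>\<^sub>2 \<in> B - A" "i \<delta>\<^sub>2 \<noteq> i' \<delta>\<^sub>2"
  shows "swap A i i' \<in> primitive_moves V I {A, B}"
proof -
  let ?j = "mix A i i'" and ?j' = "mix A i' i"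
  have j: "?j \<in> cells V I" "?j' \<in> cells V I" using i by (auto intro: mix_in_cells)
  have "\<delta>\<^sub>1 \<in> A" "\<delta>\<^sub>2 \<notin> A" using A B by auto
  note s = swap_apply[OF this(1) A(2) this(2) B(2)]
  have "{c \<in> cells V I. swap A i i' c = 1} = {i, i'}"
    "{c \<in> cells V I. swap A i i' c = -1} = {?j, ?j'}"
    unfolding s(1) using i j s(2) by (auto split: if_splits)
  moreover have "i \<noteq> i'" using A by auto
  ultimately show ?thesis using s(3) V i eq
    by (auto simp: primitive_moves_def moves_def swap_arrays marginal_swap_zero s(1))
qed

text \<open>Vanishing marginals match the negative cells with the positive ones on \<open>A\<close>
  and again on \<open>B\<close>. As \<open>A\<close> and \<open>B\<close> together determine a cell,
  the two matchings must be opposite, which is a swap.\<close>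

lemma primitive_imp_swap:
  assumes V: "finite V" and AB: "A \<union> B = V" and z: "z \<in> primitive_moves V I {A, B}"
  obtains i i' where "i \<in> cells V I" "i' \<in> cells V I" "z = swap A i i'" "\<forall>\<delta>\<in>A \<inter> B. i \<delta> = i' \<delta>"
    "\<exists>\<delta>\<in>A - B. i \<delta> \<noteq> i' \<delta>" "\<exists>\<delta>\<in>B - A. i \<delta> \<noteq> i' \<delta>"
proof -
  note thesisI = that
  have z0: "z c = 0" if "c \<notin> cells V I" for c
    using z that by (auto simp: primitive_moves_def moves_def arrays_def)
  have m: "marginal V I z D k = 0" if "D = A \<or> D = B" "k \<in> cells D I" for D k
    using z that by (auto simp: primitive_moves_def moves_def)
  have zv: "z c \<in> {-1, 0, 1}" if "c \<in> cells V I" for c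
    using z that by (auto simp: primitive_moves_def)
  obtain i i' where ii: "{c \<in> cells V I. z c = 1} = {i, i'}" "i \<noteq> i'"
    using z by (auto simp: primitive_moves_def card_2_iff)
  obtain j j' where jj: "{c \<in> cells V I. z c = -1} = {j, j'}" "j \<noteq> j'"
    using z by (auto simp: primitive_moves_def card_2_iff)
  have p: "c = i \<or> c = i' \<longleftrightarrow> c \<in> cells V I \<and> z c = 1"
    and q: "c = j \<or> c = j' \<longleftrightarrow> c \<in> cells V I \<and> z c = -1" for c
    using ii(1) jj(1) by blast+
  have i: "i \<in> cells V I" "i' \<in> cells V I" "z i = 1" "z i' = 1" using p by metis+
  have j: "j \<in> cells V I" "j' \<in> cells V I" "z j = -1" "z j' = -1" using q by metis+
  have z_eq: "z = (\<lambda>c. of_bool (c = i) + of_bool (c = i') - of_bool (c = j) - of_bool (c = j'))"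
  proof
    fix c
    show "z c = of_bool (c = i) + of_bool (c = i') - of_bool (c = j) - of_bool (c = j')"
    proof (cases "c \<in> cells V I")
      case True
      then consider "z c = -1" | "z c = 0" | "z c = 1" using zv by blast
      then show ?thesis using True p[of c] q[of c] ii(2) jj(2) i j by cases auto
    next
      case False
      then show ?thesis using z0[of c] p[of c] q[of c] by auto
    qed
  qed
  have bal: "of_bool (restrict i D = k) + of_bool (restrict i' D = k)
      - of_bool (restrict j D = k) - of_bool (restrict j' D = k) = (0::int)"
    if D: "D = A \<or> D = B" and k: "k \<in> cells D I" for D k
    using marginal_four[OF V i(1,2) j(1,2), of D k] m[OF D k] z_eq by simp
  have match: "restrict j D = restrict i D \<and> restrict j' D = restrict i' D \<or>
      restrict j D = restrict i' D \<and> restrict j' D = restrict i D" if D: "D = A \<or> D = B" for D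
  proof -
    have "D \<subseteq> V" using D AB by blast
    then have "restrict i D \<in> cells D I" "restrict i' D \<in> cells D I"
      using restrict_in_cells i by blast+
    from bal[OF D this(1)] bal[OF D this(2)] show ?thesis
      by (auto simp: of_bool_def split: if_splits)
  qed
  \<comment> \<open>\<open>k\<close> names the negative cell with the \<open>A\<close>-part of
    \<open>i'\<close> and the \<open>B\<close>-part of \<open>i\<close>; it is \<open>j\<close> or
    \<open>j'\<close> depending on the matching.\<close>
  have swapE: thesis if k: "k \<in> cells V I" "k' \<in> cells V I" "{k, k'} = {j, j'}" "k \<noteq> k'"
    and A: "restrict k A = restrict i' A" "restrict k' A = restrict i A"
    and B: "restrict k B = restrict i B" "restrict k' B = restrict i' B" for k k'
  proof -
    have A': "\<forall>\<delta>\<in>A. k \<delta> = i' \<delta> \<and> k' \<delta> = i \<delta>" and B': "\<forall>\<delta>\<in>B. k \<delta> = i \<delta> \<and> k' \<delta> = i' \<delta>"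
      using A B by (auto simp: restrict_eq_iff)
    have "k = mix A i i'"
    proof (rule cells_eqI[OF k(1) mix_in_cells[OF i(1,2)]])
      fix \<delta> assume "\<delta> \<in> V"
      then show "k \<delta> = mix A i i' \<delta>" using A' B' AB by (cases "\<delta> \<in> A") (auto simp: mix_def)
    qed
    moreover have "k' = mix A i' i"
    proof (rule cells_eqI[OF k(2) mix_in_cells[OF i(2,1)]])
      fix \<delta> assume "\<delta> \<in> V"
      then show "k' \<delta> = mix A i' i \<delta>" using A' B' AB by (cases "\<delta> \<in> A") (auto simp: mix_def)
    qed
    moreover have "z = (\<lambda>c. of_bool (c = i) + of_bool (c = i') - of_bool (c = k) - of_bool (c = k'))"
      using k(3,4) z_eq by (auto simp: doubleton_eq_iff)
    ultimately have "z = swap A i i'" by (simp add: swap_def)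
    moreover have eq: "\<forall>\<delta>\<in>A \<inter> B. i \<delta> = i' \<delta>" using A' B' by auto
    moreover have "\<exists>\<delta>\<in>A - B. i \<delta> \<noteq> i' \<delta>"
    proof (rule ccontr)
      assume "\<not> (\<exists>\<delta>\<in>A - B. i \<delta> \<noteq> i' \<delta>)"
      then have "k = i" using A' B' AB eq by (intro cells_eqI[OF k(1) i(1)]) fastforce
      then show False using k(3) i j by (auto simp: doubleton_eq_iff)
    qed
    moreover have "\<exists>\<delta>\<in>B - A. i \<delta> \<noteq> i' \<delta>"
    proof (rule ccontr)
      assume "\<not> (\<exists>\<delta>\<in>B - A. i \<delta> \<noteq> i' \<delta>)"
      then have "k' = i" using A' B' AB eq by (intro cells_eqI[OF k(2) i(1)]) fastforce
      then show False using k(3) i j by (auto simp: doubleton_eq_iff)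
    qed
    ultimately show thesis by (rule thesisI[OF i(1,2)])
  qed
  \<comment> \<open>A negative cell matching the same positive cell on both sets would equal it, so
    the matching on \<open>B\<close> is the reverse of that on \<open>A\<close>.\<close>
  have no: False if "k \<in> {j, j'}" "l \<in> {i, i'}" "restrict k A = restrict l A" "restrict k B = restrict l B" for k l
  proof -
    have "k = l" using that i j AB
      by (intro cells_eqI[of k V I l]) (auto simp: restrict_eq_iff)
    then show False using that i j by auto
  qed
  from match[of A] have "restrict j A = restrict i A \<and> restrict j' A = restrict i' A \<or>
      restrict j A = restrict i' A \<and> restrict j' A = restrict i A" by simp
  then show thesis
  proof
    assume A: "restrict j A = restrict i A \<and> restrict j' A = restrict i' A"
    then have "restrict j B = restrict i' B \<and> restrict j' B = restrict i B"
      using match[of B] no[of j i] by blast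
    then show thesis using A jj(2) by (intro swapE[OF j(2,1)]) auto
  next
    assume A: "restrict j A = restrict i' A \<and> restrict j' A = restrict i A"
    then have "restrict j B = restrict i B \<and> restrict j' B = restrict i' B"
      using match[of B] no[of j i'] by blast
    then show thesis using A jj(2) by (intro swapE[OF j(1,2)]) auto
  qed
qed

lemma primitive_moves_iff:
  assumes "finite V" "A \<union> B = V"
  shows "z \<in> primitive_moves V I {A, B} \<longleftrightarrow> (\<exists>i\<in>cells V I. \<exists>i'\<in>cells V I. z = swap A i i' \<and>
    (\<forall>\<delta>\<in>A \<inter> B. i \<delta> = i' \<delta>) \<and> (\<exists>\<delta>\<in>A - B. i \<delta> \<noteq> i' \<delta>) \<and> (\<exists>\<delta>\<in>B - A. i \<delta> \<noteq> i' \<delta>))"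
proof
  assume "z \<in> primitive_moves V I {A, B}"
  then show "\<exists>i\<in>cells V I. \<exists>i'\<in>cells V I. z = swap A i i' \<and>
    (\<forall>\<delta>\<in>A \<inter> B. i \<delta> = i' \<delta>) \<and> (\<exists>\<delta>\<in>A - B. i \<delta> \<noteq> i' \<delta>) \<and> (\<exists>\<delta>\<in>B - A. i \<delta> \<noteq> i' \<delta>)"
    by (rule primitive_imp_swap[OF assms]) blast
next
  assume "\<exists>i\<in>cells V I. \<exists>i'\<in>cells V I. z = swap A i i' \<and>
    (\<forall>\<delta>\<in>A \<inter> B. i \<delta> = i' \<delta>) \<and> (\<exists>\<delta>\<in>A - B. i \<delta> \<noteq> i' \<delta>) \<and> (\<exists>\<delta>\<in>B - A. i \<delta> \<noteq> i' \<delta>)"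
  then show "z \<in> primitive_moves V I {A, B}"
    by (elim bexE conjE, simp only:) (blast intro: swap_primitive[OF assms(1)])
qed

section \<open>The action of level permutations on swaps\<close>

definition app :: "'v set \<Rightarrow> ('v \<Rightarrow> nat \<Rightarrow> nat) \<Rightarrow> ('v \<Rightarrow> nat) \<Rightarrow> 'v \<Rightarrow> nat" where
  "app V g i = (\<lambda>\<delta>\<in>V. g \<delta> (i \<delta>))"

lemma app_in_cells: "g \<in> level_perms V I \<Longrightarrow> i \<in> cells V I \<Longrightarrow> app V g i \<in> cells V I"
  by (auto simp: cells_iff app_def level_perms_def dest!: bspec permutes_in_image)

text \<open>\<open>mix\<close> works coordinatewise and so commutes with level permutations; the
  inverse in \<open>act\<close> carries the indicator of a cell to the indicator of its
  image.\<close>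

lemma act_swap:
  assumes g: "g \<in> level_perms V I" and i: "i \<in> cells V I" "i' \<in> cells V I"
  shows "act V I g (swap A i i') = swap A (app V g i) (app V g i')"
proof
  fix c
  have mix: "app V g (mix A j j') = mix A (app V g j) (app V g j')" for j j'
    by (auto simp: app_def mix_def restrict_def)
  have inv_iff: "(\<lambda>\<delta>\<in>V. inv (g \<delta>) (c \<delta>)) = k \<longleftrightarrow> c = app V g k"
    if c: "c \<in> cells V I" and k: "k \<in> cells V I" for k
  proof -
    have perm: "inv (g \<delta>) x = y \<longleftrightarrow> x = g \<delta> y" if "\<delta> \<in> V" for \<delta> x y
    proof -
      have "g \<delta> permutes {0..<I \<delta>}" using g that by (simp add: level_perms_def)
      from permutes_inv_eq[OF this] show ?thesis by auto
    qed
    have "(\<lambda>\<delta>\<in>V. inv (g \<delta>) (c \<delta>)) = k \<longleftrightarrow> (\<forall>\<delta>\<in>V. inv (g \<delta>) (c \<delta>) = k \<delta>)"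
      using k by (auto simp: fun_eq_iff cells_iff)
    also have "\<dots> \<longleftrightarrow> (\<forall>\<delta>\<in>V. c \<delta> = g \<delta> (k \<delta>))" using perm by blast
    also have "\<dots> \<longleftrightarrow> c = app V g k"
      using c by (auto simp: fun_eq_iff cells_iff app_def)
    finally show ?thesis .
  qed
  show "act V I g (swap A i i') c = swap A (app V g i) (app V g i') c"
  proof (cases "c \<in> cells V I")
    case True
    then show ?thesis using i
      by (simp add: act_def swap_def inv_iff mix_in_cells flip: mix)
  next
    case False
    then show ?thesis
      using swap_arrays[OF app_in_cells[OF g i(1)] app_in_cells[OF g i(2)], of A]
      by (simp add: act_def arrays_def)
  qed
qed

lemma act_uminus: "act V I g (- z) = - act V I g z"
  by (auto simp: act_def fun_eq_iff)

lemma app_eq_iff: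
  assumes "g \<in> level_perms V I" "\<delta> \<in> V"
  shows "app V g i \<delta> = app V g i' \<delta> \<longleftrightarrow> i \<delta> = i' \<delta>"
  using assms permutes_inj[of "g \<delta>"] by (auto simp: app_def level_perms_def dest: injD)

lemma act_primitive:
  assumes V: "finite V" "A \<union> B = V" and g: "g \<in> level_perms V I" and z: "z \<in> primitive_moves V I {A, B}"
  shows "act V I g z \<in> primitive_moves V I {A, B}"
proof -
  obtain i i' where i: "i \<in> cells V I" "i' \<in> cells V I" "z = swap A i i'" "\<forall>\<delta>\<in>A \<inter> B. i \<delta> = i' \<delta>"
    "\<exists>\<delta>\<in>A - B. i \<delta> \<noteq> i' \<delta>" "\<exists>\<delta>\<in>B - A. i \<delta> \<noteq> i' \<delta>"
    by (rule primitive_imp_swap[OF V z])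
  have "app V g i \<delta> = app V g i' \<delta> \<longleftrightarrow> i \<delta> = i' \<delta>" if "\<delta> \<in> A \<or> \<delta> \<in> B" for \<delta>
    using app_eq_iff[OF g] that V(2) by blast
  then show ?thesis
    unfolding primitive_moves_iff[OF V]
    using i act_swap[OF g i(1,2)] app_in_cells[OF g i(1)] app_in_cells[OF g i(2)] by blast
qed

section \<open>The moves of a clique tree form a Markov basis\<close>

definition fiber_step where
  "fiber_step V I \<D> b M = (\<lambda>x y. x \<in> fiber V I \<D> b \<and> y \<in> fiber V I \<D> b \<and>
     (\<exists>z\<in>M. y - x = z \<or> y - x = - z))"

lemma markov_basis_iff:
  "markov_basis V I \<D> M \<longleftrightarrow> finite M \<and> M \<subseteq> moves V I \<D> \<and>
     (\<forall>b. \<forall>n\<in>fiber V I \<D> b. \<forall>n'\<in>fiber V I \<D> b. (fiber_step V I \<D> b M)\<^sup>*\<^sup>* n n')"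
  by (simp add: markov_basis_def fiber_step_def)

lemma marginal_fun_diff:
  "finite V \<Longrightarrow> marginal V I (f - g) D j = marginal V I f D j - marginal V I g D j"
  using marginal_diff[of V I f g] by (simp add: fun_diff_def)

text \<open>Subtraction removes units only at \<open>i\<close> and \<open>i'\<close>. Both are
  occupied and they are distinct, so neither entry becomes negative.\<close>

lemma fiber_minus_swap:
  assumes V: "finite V" and x: "x \<in> fiber V I \<D> b" and z: "swap A i i' \<in> moves V I \<D>"
    and pos: "i \<noteq> i'" "0 < x i" "0 < x i'"
  shows "x - swap A i i' \<in> fiber V I \<D> b"
proof -
  have "x - swap A i i' \<in> arrays V I"
    using x z by (auto simp: fiber_def tables_def arrays_def moves_def)
  moreover have "0 \<le> (x - swap A i i') c" for c
  proof -
    have "0 \<le> x c" using x by (auto simp: fiber_def tables_def)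
    then show ?thesis using pos by (auto simp: swap_def)
  qed
  ultimately show ?thesis using x z
    by (simp add: fiber_def tables_def moves_def marginal_fun_diff[OF V])
qed

lemma marginal_marginal:
  assumes V: "finite V" and "D \<subseteq> K" "K \<subseteq> V"
  shows "marginal V I x D h = (\<Sum>k\<in>{k \<in> cells K I. restrict k D = h}. marginal V I x K k)"
proof -
  let ?S = "{i \<in> cells V I. restrict i D = h}" and ?T = "{k \<in> cells K I. restrict k D = h}"
  have K: "finite K" using assms finite_subset by blast
  have KD: "K \<inter> D = D" using assms(2) by blast
  have "(\<Sum>k\<in>?T. marginal V I x K k) = (\<Sum>k\<in>?T. \<Sum>i\<in>{i \<in> ?S. restrict i K = k}. x i)"
    unfolding marginal_def by (intro sum.cong refl) (auto simp: KD)
  also have "\<dots> = (\<Sum>i\<in>?S. x i)"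
    using finite_cells[OF V] finite_cells[OF K] restrict_in_cells[OF _ assms(3)]
    by (intro sum.group) (auto simp: KD)
  finally show ?thesis by (simp add: marginal_def)
qed

lemma sum_zero_ex_neg:
  fixes w :: "'a \<Rightarrow> int"
  assumes "finite S" "sum w S = 0" "a \<in> S" "0 < w a"
  shows "\<exists>b\<in>S. w b < 0"
proof (rule ccontr)
  assume "\<not> (\<exists>b\<in>S. w b < 0)"
  then have "\<forall>b\<in>S. 0 \<le> w b" by auto
  then have "w a = 0" using sum_nonneg_eq_0_iff[OF assms(1), of w] assms(2,3) by blast
  then show False using assms(4) by simp
qed

lemma sum_zero_ex_pos:
  fixes w :: "'a \<Rightarrow> int"
  assumes "finite S" "sum w S = 0" "a \<in> S" "w a < 0"
  shows "\<exists>b\<in>S. 0 < w b"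
  using sum_zero_ex_neg[of S "\<lambda>x. - w x" a] assms by (simp add: sum_negf)

text \<open>Three of the four unit changes shrink an absolute value. Nothing is known about the sign
  at \<open>k4\<close>, which costs at most one, so the net decrease is at least two.\<close>

lemma l1_decrease:
  fixes w :: "'a \<Rightarrow> int"
  assumes S: "finite S" and k: "k1 \<in> S" "k2 \<in> S" "k3 \<in> S" "k4 \<in> S" and "k1 \<noteq> k2"
    and w: "0 < w k1" "0 < w k2" "w k3 < 0"
  shows "(\<Sum>k\<in>S. \<bar>w k - of_bool (k = k1) - of_bool (k = k2) + of_bool (k = k3) + of_bool (k = k4)\<bar>)
    < (\<Sum>k\<in>S. \<bar>w k\<bar>)"
proof -
  have "k3 \<noteq> k1" "k3 \<noteq> k2" using w by auto
  have "(\<Sum>k\<in>S. \<bar>w k - of_bool (k = k1) - of_bool (k = k2) + of_bool (k = k3) + of_bool (k = k4)\<bar>)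
    \<le> (\<Sum>k\<in>S. \<bar>w k\<bar> - of_bool (k = k1) - of_bool (k = k2) - of_bool (k = k3) + of_bool (k = k4))"
    using w \<open>k1 \<noteq> k2\<close> \<open>k3 \<noteq> k1\<close> \<open>k3 \<noteq> k2\<close> by (intro sum_mono) (auto simp: of_bool_def)
  also have "\<dots> = (\<Sum>k\<in>S. \<bar>w k\<bar>) - 2"
    using S k by (simp add: sum.distrib sum_subtractf of_bool_def sum.delta)
  finally show ?thesis by linarith
qed

lemma marginal_pos_imp:
  assumes "finite V" "0 < marginal V I x K k"
  shows "\<exists>i\<in>cells V I. restrict i K = k \<and> 0 < x i"
proof (rule ccontr)
  assume "\<not> ?thesis"
  then have "marginal V I x K k \<le> 0"
    unfolding marginal_def by (intro sum_nonpos) auto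
  then show False using assms by simp
qed

lemma marginal_nonneg: "n \<in> fiber V I \<D> b \<Longrightarrow> 0 \<le> marginal V I n K k"
  unfolding marginal_def by (intro sum_nonneg) (auto simp: fiber_def tables_def)

text \<open>\<open>H\<close> is the part already glued and \<open>C\<close> the new clique.
  Induction on the L1-distance of the marginals on \<open>H \<union> C\<close>: as long as it is
  positive, a swap across the cut lowers it and keeps the marginals on \<open>H\<close> and
  \<open>C\<close>.\<close>

lemma glue_marginals:
  assumes V: "finite V" and AB: "A \<union> B = V"
    and M: "primitive_moves V I {A, B} \<subseteq> M" "M \<subseteq> moves V I \<D>"
    and H: "H \<subseteq> B" and C: "C \<subseteq> A" and S: "A \<inter> B \<subseteq> H \<inter> C"
    and n: "n \<in> fiber V I \<D> b" and x: "x \<in> fiber V I \<D> b"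
    and mH: "\<forall>k\<in>cells H I. marginal V I x H k = marginal V I n H k"
    and mC: "\<forall>k\<in>cells C I. marginal V I x C k = marginal V I n C k"
  shows "\<exists>y. (fiber_step V I \<D> b M)\<^sup>*\<^sup>* x y \<and> y \<in> fiber V I \<D> b \<and>
    (\<forall>k\<in>cells (H \<union> C) I. marginal V I y (H \<union> C) k = marginal V I n (H \<union> C) k)"
  using x mH mC
proof (induction "nat (\<Sum>k\<in>cells (H \<union> C) I. \<bar>marginal V I x (H \<union> C) k - marginal V I n (H \<union> C) k\<bar>)"
    arbitrary: x rule: less_induct)
  case less
  note x = less(2) and mH = less(3) and mC = less(4)
  let ?K = "H \<union> C"
  define w where "w k = marginal V I x ?K k - marginal V I n ?K k" for k
  have KV: "?K \<subseteq> V" using H C AB by blast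
  have fK: "finite (cells ?K I)" using finite_cells finite_subset[OF KV V] by blast
  show ?case
  proof (cases "\<forall>k\<in>cells ?K I. w k = 0")
    case True
    then show ?thesis using x by (intro exI[of _ x]) (simp add: w_def)
  next
    case False
    then obtain k0 where k0: "k0 \<in> cells ?K I" "w k0 \<noteq> 0" by blast
    \<comment> \<open>Since the marginals on \<open>H\<close> and on \<open>C\<close> agree, surplus
      and deficit cancel over all cells with a common restriction to \<open>H\<close> or to
      \<open>C\<close>.\<close>
    have sum0: "(\<Sum>k\<in>{k \<in> cells ?K I. restrict k D = restrict l D}. w k) = 0"
      if D: "D = H \<or> D = C" and l: "l \<in> cells ?K I" for D l
    proof -
      have "D \<subseteq> ?K" using D by blast
      then have l': "restrict l D \<in> cells D I" using restrict_in_cells[OF l] by blast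
      then have "marginal V I x D (restrict l D) = marginal V I n D (restrict l D)"
        using D mH mC by blast
      then show ?thesis
        unfolding w_def sum_subtractf using marginal_marginal[OF V \<open>D \<subseteq> ?K\<close> KV, of I] by simp
    qed
    have neg: "\<exists>k\<in>cells ?K I. restrict k D = restrict l D \<and> w k < 0"
      if "D = H \<or> D = C" "l \<in> cells ?K I" "0 < w l" for D l
      using sum_zero_ex_neg[OF _ sum0[OF that(1,2)], of l] that fK by auto
    have pos: "\<exists>k\<in>cells ?K I. restrict k D = restrict l D \<and> 0 < w k"
      if "D = H \<or> D = C" "l \<in> cells ?K I" "w l < 0" for D l
      using sum_zero_ex_pos[OF _ sum0[OF that(1,2)], of l] that fK by auto
    \<comment> \<open>The deficit cell \<open>k3\<close> has the \<open>H\<close>-part of the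
      surplus cell \<open>k1\<close> and the \<open>C\<close>-part of the surplus cell
      \<open>k2\<close>. The swap is chosen to move a unit into \<open>k3\<close>.\<close>
    obtain k1 where k1: "k1 \<in> cells ?K I" "0 < w k1"
      using k0 pos[of H k0] by (cases "0 < w k0") auto
    obtain k3 where k3: "k3 \<in> cells ?K I" "restrict k3 H = restrict k1 H" "w k3 < 0"
      using neg[of H k1] k1 by blast
    obtain k2 where k2: "k2 \<in> cells ?K I" "restrict k2 C = restrict k3 C" "0 < w k2"
      using pos[of C k3] k3 by blast
    have xpos: "\<exists>i\<in>cells V I. restrict i ?K = k \<and> 0 < x i" if "0 < w k" for k
    proof (rule marginal_pos_imp[OF V])
      show "0 < marginal V I x ?K k"
        using that marginal_nonneg[OF n, of ?K k] unfolding w_def by linarith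
    qed
    obtain i where i: "i \<in> cells V I" "restrict i ?K = k1" "0 < x i" using xpos k1 by blast
    obtain i' where i': "i' \<in> cells V I" "restrict i' ?K = k2" "0 < x i'" using xpos k2 by blast
    have iK: "\<forall>\<delta>\<in>?K. k1 \<delta> = i \<delta> \<and> k2 \<delta> = i' \<delta>" using i i' by auto
    have k3H: "\<forall>\<delta>\<in>H. k3 \<delta> = i \<delta>" using k3(2) iK by (auto simp: restrict_eq_iff)
    have k3C: "\<forall>\<delta>\<in>C. k3 \<delta> = i' \<delta>" using k2(2) iK by (auto simp: restrict_eq_iff)
    \<comment> \<open>Both cells agree with \<open>k3\<close> on the overlap, which lies in
      \<open>H\<close> and in \<open>C\<close>.\<close>
    have eq: "\<forall>\<delta>\<in>A \<inter> B. i \<delta> = i' \<delta>" using k3H k3C S by (metis IntD1 IntD2 subsetD)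
    have "k3 \<noteq> k1" "k3 \<noteq> k2" using k1 k2 k3 by auto
    obtain d1 where d1: "d1 \<in> C" "k3 d1 \<noteq> i d1"
      using cells_eqI[OF k3(1) k1(1)] \<open>k3 \<noteq> k1\<close> iK k3H by (metis UnE)
    obtain d2 where d2: "d2 \<in> H" "k3 d2 \<noteq> i' d2"
      using cells_eqI[OF k3(1) k2(1)] \<open>k3 \<noteq> k2\<close> iK k3C by (metis UnE)
    have ne1: "i d1 \<noteq> i' d1" and ne2: "i d2 \<noteq> i' d2" using d1 d2 k3H k3C by metis+
    have "d1 \<in> A - B" "d2 \<in> B - A" using d1 d2 ne1 ne2 eq H C by blast+
    then have prim: "swap A i i' \<in> M"
      using swap_primitive[OF V i(1) i'(1) eq _ ne1 _ ne2] M(1) by blast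
    have "i \<noteq> i'" using ne1 by auto
    define y where "y = x - swap A i i'"
    have y: "y \<in> fiber V I \<D> b"
      unfolding y_def using fiber_minus_swap[OF V x _ \<open>i \<noteq> i'\<close> i(3) i'(3)] prim M(2) by blast
    have "y - x = - swap A i i'" by (simp add: y_def fun_eq_iff)
    then have step: "fiber_step V I \<D> b M x y"
      using x y prim by (auto simp: fiber_step_def)
    have mz: "marginal V I y D k = marginal V I x D k" if "D = H \<or> D = C" for D k
    proof -
      have "D \<subseteq> A \<or> D \<subseteq> B" using that H C by blast
      then show ?thesis
        unfolding y_def using marginal_swap_zero[OF V i(1) i'(1) eq] by (simp add: marginal_fun_diff[OF V])
    qed
    have r3: "restrict (mix A i i') ?K = k3"
    proof (rule cells_eqI[OF restrict_in_cells[OF mix_in_cells[OF i(1) i'(1)] KV] k3(1)])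
      fix \<delta> assume \<delta>: "\<delta> \<in> ?K"
      show "restrict (mix A i i') ?K \<delta> = k3 \<delta>"
      proof (cases "\<delta> \<in> C")
        case True
        then show ?thesis using C k3C by (auto simp: mix_def)
      next
        case False
        then have "\<delta> \<in> H" "\<delta> \<notin> A" using \<delta> H S by blast+
        then show ?thesis using k3H by (auto simp: mix_def)
      qed
    qed
    let ?k4 = "restrict (mix A i' i) ?K"
    have k4: "?k4 \<in> cells ?K I" using restrict_in_cells[OF mix_in_cells[OF i'(1) i(1)] KV] .
    have "marginal V I y ?K k - marginal V I n ?K k
        = w k - of_bool (k = k1) - of_bool (k = k2) + of_bool (k = k3) + of_bool (k = ?k4)" for k
      unfolding y_def marginal_fun_diff[OF V] marginal_swap[OF V i(1) i'(1)] r3 i(2) i'(2) w_def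
      by (simp add: eq_commute)
    moreover have k12: "k1 \<noteq> k2" using ne1 iK d1(1) by (metis UnI2)
    ultimately have "(\<Sum>k\<in>cells ?K I. \<bar>marginal V I y ?K k - marginal V I n ?K k\<bar>)
        < (\<Sum>k\<in>cells ?K I. \<bar>w k\<bar>)"
      using l1_decrease[where w = w, OF fK k1(1) k2(1) k3(1) k4 k12 k1(2) k2(3) k3(3)] by simp
    moreover have "0 \<le> (\<Sum>k\<in>cells ?K I. \<bar>marginal V I y ?K k - marginal V I n ?K k\<bar>)"
      by (intro sum_nonneg) simp
    ultimately have "nat (\<Sum>k\<in>cells ?K I. \<bar>marginal V I y ?K k - marginal V I n ?K k\<bar>)
        < nat (\<Sum>k\<in>cells ?K I. \<bar>marginal V I x ?K k - marginal V I n ?K k\<bar>)"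
      unfolding w_def by linarith
    from less(1)[OF this y] obtain y' where y': "(fiber_step V I \<D> b M)\<^sup>*\<^sup>* y y'" "y' \<in> fiber V I \<D> b"
      "\<forall>k\<in>cells ?K I. marginal V I y' ?K k = marginal V I n ?K k"
      using mH mC mz by auto
    have "(fiber_step V I \<D> b M)\<^sup>*\<^sup>* x y'"
      using step y'(1) by (rule converse_rtranclp_into_rtranclp)
    then show ?thesis using y' by blast
  qed
qed

section \<open>Assembly along the clique tree\<close>

lemma reachable_crossing:
  assumes "reachable E u v" "u \<in> X" "v \<notin> X"
  obtains p q where "{p, q} \<in> E" "p \<in> X" "q \<notin> X"
proof -
  have "v \<notin> X \<longrightarrow> (\<exists>p q. {p, q} \<in> E \<and> p \<in> X \<and> q \<notin> X)"
    using assms(1)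
  proof (induction rule: reachable_induct)
    case (step v w)
    then show ?case by (cases "v \<in> X") blast+
  qed (use assms(2) in simp)
  then show ?thesis using assms(3) that by blast
qed

lemma tree_moves_edge:
  assumes "clique_tree \<D> \<E>" and e: "{P, Q} \<in> \<E>"
  shows "primitive_moves V I {\<Union>(side \<D> \<E> {P, Q} P), \<Union>(side \<D> \<E> {P, Q} Q)} \<subseteq> tree_moves V I \<D> \<E>"
proof -
  have "tree \<D> \<E>" using assms by (simp add: clique_tree_def)
  from components_remove_edge[OF this e]
  have "Union ` components \<D> (\<E> - {{P, Q}}) = {\<Union>(side \<D> \<E> {P, Q} P), \<Union>(side \<D> \<E> {P, Q} Q)}"
    by simp
  then show ?thesis unfolding tree_moves_def by (metis UN_upper e)
qed

lemma tree_movesE: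
  assumes "clique_tree \<D> \<E>" and "z \<in> tree_moves V I \<D> \<E>"
  obtains P Q where "{P, Q} \<in> \<E>"
    "z \<in> primitive_moves V I {\<Union>(side \<D> \<E> {P, Q} P), \<Union>(side \<D> \<E> {P, Q} Q)}"
proof -
  have t: "tree \<D> \<E>" using assms by (simp add: clique_tree_def)
  obtain e where e: "e \<in> \<E>" "z \<in> primitive_moves V I (Union ` components \<D> (\<E> - {e}))"
    using assms(2) by (auto simp: tree_moves_def)
  obtain P Q where PQ: "e = {P, Q}" by (rule simple_graph_edgeE[OF tree_simple[OF t] e(1)])
  show ?thesis using that[of P Q] e components_remove_edge[OF t, of P Q] unfolding PQ by simp
qed

lemma sides_Union:
  assumes "clique_tree \<D> \<E>" and e: "{P, Q} \<in> \<E>"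
  shows "\<Union>(side \<D> \<E> {P, Q} P) \<union> \<Union>(side \<D> \<E> {P, Q} Q) = \<Union>\<D>"
    and "\<forall>D\<in>\<D>. D \<subseteq> \<Union>(side \<D> \<E> {P, Q} P) \<or> D \<subseteq> \<Union>(side \<D> \<E> {P, Q} Q)"
proof -
  have "tree \<D> \<E>" using assms by (simp add: clique_tree_def)
  from sides_cover[OF this e]
  show "\<Union>(side \<D> \<E> {P, Q} P) \<union> \<Union>(side \<D> \<E> {P, Q} Q) = \<Union>\<D>"
    and "\<forall>D\<in>\<D>. D \<subseteq> \<Union>(side \<D> \<E> {P, Q} P) \<or> D \<subseteq> \<Union>(side \<D> \<E> {P, Q} Q)"
    by blast+
qed

text \<open>Every clique lies within one side of the edge, where the marginals of a swap
  vanish.\<close>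

lemma tree_moves_subset_moves:
  assumes V: "finite V" "\<Union>\<D> = V" and ct: "clique_tree \<D> \<E>"
  shows "tree_moves V I \<D> \<E> \<subseteq> moves V I \<D>"
proof
  fix z assume "z \<in> tree_moves V I \<D> \<E>"
  then obtain P Q where e: "{P, Q} \<in> \<E>"
    and z: "z \<in> primitive_moves V I {\<Union>(side \<D> \<E> {P, Q} P), \<Union>(side \<D> \<E> {P, Q} Q)}"
    by (rule tree_movesE[OF ct])
  let ?A = "\<Union>(side \<D> \<E> {P, Q} P)" and ?B = "\<Union>(side \<D> \<E> {P, Q} Q)"
  have AB: "?A \<union> ?B = V" using sides_Union(1)[OF ct e] V by simp
  obtain i i' where i: "i \<in> cells V I" "i' \<in> cells V I" "z = swap ?A i i'" "\<forall>\<delta>\<in>?A \<inter> ?B. i \<delta> = i' \<delta>"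
    by (rule primitive_imp_swap[OF V(1) AB z])
  show "z \<in> moves V I \<D>"
    unfolding moves_def i(3) using swap_arrays[OF i(1,2)] marginal_swap_zero[OF V(1) i(1,2,4)]
      sides_Union(2)[OF ct e] by blast
qed

lemma tree_moves_connect:
  assumes V: "finite V" "\<Union>\<D> = V" and ct: "clique_tree \<D> \<E>" and fin: "finite \<D>"
    and x: "x \<in> fiber V I \<D> b" and n: "n \<in> fiber V I \<D> b"
  shows "(fiber_step V I \<D> b (tree_moves V I \<D> \<E>))\<^sup>*\<^sup>* x n"
proof -
  let ?R = "fiber_step V I \<D> b (tree_moves V I \<D> \<E>)"
  have tr: "tree \<D> \<E>" using ct by (simp add: clique_tree_def)
  have mD: "\<forall>k\<in>cells D I. marginal V I y D k = marginal V I n D k" if "y \<in> fiber V I \<D> b" "D \<in> \<D>" for y D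
    using that n by (simp add: fiber_def)
  \<comment> \<open>At stage \<open>k\<close>, \<open>Suc k\<close> cliques are glued. Besides the
    marginals, connectivity by walks inside \<open>X\<close> is carried along, so that
    \<open>X\<close> stays on one side of the next edge.\<close>
  have main: "\<exists>X y R. X \<subseteq> \<D> \<and> card X = Suc k \<and> R \<in> X \<and> (\<forall>C\<in>X. reachable {f \<in> \<E>. f \<subseteq> X} R C) \<and>
      ?R\<^sup>*\<^sup>* x y \<and> y \<in> fiber V I \<D> b \<and> (\<forall>k\<in>cells (\<Union>X) I. marginal V I y (\<Union>X) k = marginal V I n (\<Union>X) k)"
    if "k < card \<D>" for k
    using that
  proof (induction k)
    case 0
    obtain P where "P \<in> \<D>" using tr by (auto simp: tree_def)
    then show ?case using x mD[OF x, of P]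
      by (intro exI[of _ "{P}"] exI[of _ x] exI[of _ P]) (simp add: reachable_refl)
  next
    case (Suc k)
    then obtain X y R where X: "X \<subseteq> \<D>" "card X = Suc k" "R \<in> X"
      and con: "\<forall>C\<in>X. reachable {f \<in> \<E>. f \<subseteq> X} R C"
      and y: "?R\<^sup>*\<^sup>* x y" "y \<in> fiber V I \<D> b"
      and my: "\<forall>k\<in>cells (\<Union>X) I. marginal V I y (\<Union>X) k = marginal V I n (\<Union>X) k"
      by auto
    have fX: "finite X" using X fin finite_subset by blast
    obtain Z where Z: "Z \<in> \<D>" "Z \<notin> X" using X Suc.prems by (metis less_irrefl subsetI subset_antisym)
    have "R \<in> \<D>" using X by blast
    then have RZ: "reachable \<E> R Z" using tr Z(1) by (simp add: tree_def)
    obtain P Q where e: "{P, Q} \<in> \<E>" and P: "P \<in> X" and Q: "Q \<notin> X"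
      by (rule reachable_crossing[OF RZ X(3) Z(2)])
    have PD: "P \<in> \<D>" and QD: "Q \<in> \<D>" using simple_graph_edge[OF tree_simple[OF tr] e] by auto
    let ?A = "\<Union>(side \<D> \<E> {P, Q} Q)" and ?B = "\<Union>(side \<D> \<E> {P, Q} P)"
    \<comment> \<open>The connecting walks stay in \<open>X\<close>, which misses \<open>Q\<close>,
      and thus avoid the new edge.\<close>
    have "X \<subseteq> side \<D> \<E> {P, Q} P"
    proof
      fix C assume C: "C \<in> X"
      then have "reachable {f \<in> \<E>. f \<subseteq> X} P C"
        using con P by (meson reachable_sym reachable_trans)
      then have "reachable (\<E> - {{P, Q}}) P C"
        by (rule reachable_mono) (use Q in auto)
      then show "C \<in> side \<D> \<E> {P, Q} P" using C X by (auto simp: side_def)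
    qed
    then have H: "\<Union>X \<subseteq> ?B" by blast
    have C: "Q \<subseteq> ?A" using side_self[OF QD] by blast
    have S: "?A \<inter> ?B \<subseteq> \<Union>X \<inter> Q" using clique_tree_separator[OF ct e] P by blast
    have AB: "?A \<union> ?B = V" using sides_Union(1)[OF ct e] V by (simp add: Un_commute)
    have M: "primitive_moves V I {?A, ?B} \<subseteq> tree_moves V I \<D> \<E>"
      using tree_moves_edge[OF ct e] by (simp add: insert_commute)
    obtain y' where y': "?R\<^sup>*\<^sup>* y y'" "y' \<in> fiber V I \<D> b"
      "\<forall>k\<in>cells (\<Union>X \<union> Q) I. marginal V I y' (\<Union>X \<union> Q) k = marginal V I n (\<Union>X \<union> Q) k"
      using glue_marginals[OF V(1) AB M tree_moves_subset_moves[OF V ct] H C S n y(2) my mD[OF y(2) QD]] by blast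
    have mono: "reachable {f \<in> \<E>. f \<subseteq> X} R C \<Longrightarrow> reachable {f \<in> \<E>. f \<subseteq> insert Q X} R C" for C
      by (erule reachable_mono) blast
    then have "reachable {f \<in> \<E>. f \<subseteq> insert Q X} R P" using con P by blast
    then have "reachable {f \<in> \<E>. f \<subseteq> insert Q X} R Q"
      by (rule reachable_step) (use e P in auto)
    then have con': "\<forall>C\<in>insert Q X. reachable {f \<in> \<E>. f \<subseteq> insert Q X} R C" using con mono by blast
    have un: "\<Union>(insert Q X) = \<Union>X \<union> Q" by blast
    have xy': "?R\<^sup>*\<^sup>* x y'" using y(1) y'(1) by (rule rtranclp_trans)
    show ?case
    proof (intro exI conjI)
      show "insert Q X \<subseteq> \<D>" "R \<in> insert Q X" using X QD by auto
      show "card (insert Q X) = Suc (Suc k)" using X(2) Q fX by simp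
      show "\<forall>C\<in>insert Q X. reachable {f \<in> \<E>. f \<subseteq> insert Q X} R C" by (rule con')
      show "?R\<^sup>*\<^sup>* x y'" by (rule xy')
      show "y' \<in> fiber V I \<D> b" by (rule y'(2))
      show "\<forall>k\<in>cells (\<Union>(insert Q X)) I.
          marginal V I y' (\<Union>(insert Q X)) k = marginal V I n (\<Union>(insert Q X)) k"
        unfolding un by (rule y'(3))
    qed
  qed
  have dpos: "0 < card \<D>" using tr fin by (simp add: tree_def card_gt_0_iff)
  from main[of "card \<D> - 1"] obtain X y where X: "X \<subseteq> \<D>" "card X = card \<D>"
    and y: "?R\<^sup>*\<^sup>* x y" "y \<in> fiber V I \<D> b" "\<forall>k\<in>cells (\<Union>X) I. marginal V I y (\<Union>X) k = marginal V I n (\<Union>X) k"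
    using dpos by auto
  have "X = \<D>" using X fin card_subset_eq by blast
  \<comment> \<open>With \<open>X = \<D>\<close> the glued marginal is the one on all variables,
    that is, the table itself.\<close>
  have m: "marginal V I t V i = t i" if i: "i \<in> cells V I" for t i
  proof -
    have "{j \<in> cells V I. restrict j V = i} = {i}" using i restrict_cell by fastforce
    then show ?thesis by (simp add: marginal_def)
  qed
  have "y i = n i" for i
  proof (cases "i \<in> cells V I")
    case True
    then have "marginal V I y V i = marginal V I n V i" using y(3) V \<open>X = \<D>\<close> by blast
    then show ?thesis using m[OF True] by simp
  next
    case False
    then show ?thesis using y(2) n by (simp add: fiber_def tables_def arrays_def)
  qed
  then have "y = n" by blast
  then show ?thesis using y(1) by simp
qed

lemma finite_primitive_moves: "finite V \<Longrightarrow> finite (primitive_moves V I \<D>)"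
proof -
  assume V: "finite V"
  have "primitive_moves V I \<D> \<subseteq> {z. \<forall>i. (i \<in> cells V I \<longrightarrow> z i \<in> {-1, 0, 1}) \<and> (i \<notin> cells V I \<longrightarrow> z i = 0)}"
    by (auto simp: primitive_moves_def moves_def arrays_def)
  moreover have "finite {z. \<forall>i. (i \<in> cells V I \<longrightarrow> z i \<in> {-1, 0, 1}) \<and> (i \<notin> cells V I \<longrightarrow> z i = (0::int))}"
    using finite_cells[OF V] by (intro finite_set_of_finite_funs) auto
  ultimately show ?thesis by (rule finite_subset)
qed

lemma tree_moves_markov_basis:
  assumes V: "finite V" "\<Union>\<D> = V" and ct: "clique_tree \<D> \<E>"
  shows "markov_basis V I \<D> (tree_moves V I \<D> \<E>)"
proof -
  have fin: "finite \<D>" using V finite_UnionD by blast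
  have "\<E> \<subseteq> Pow \<D>" using ct by (auto simp: clique_tree_def tree_def simple_graph_def)
  then have "finite \<E>" using fin finite_subset by blast
  then have "finite (tree_moves V I \<D> \<E>)"
    unfolding tree_moves_def using finite_primitive_moves[OF V(1)] by blast
  then show ?thesis
    unfolding markov_basis_iff
    using tree_moves_subset_moves[OF V ct] tree_moves_connect[OF V ct fin] by blast
qed

lemma act_tree_moves:
  assumes V: "finite V" "\<Union>\<D> = V" and ct: "clique_tree \<D> \<E>"
    and "g \<in> level_perms V I" "z \<in> tree_moves V I \<D> \<E>"
  shows "act V I g z \<in> tree_moves V I \<D> \<E>"
proof -
  obtain P Q where e: "{P, Q} \<in> \<E>"
    and z: "z \<in> primitive_moves V I {\<Union>(side \<D> \<E> {P, Q} P), \<Union>(side \<D> \<E> {P, Q} Q)}"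
    using tree_movesE[OF ct assms(5)] .
  have "\<Union>(side \<D> \<E> {P, Q} P) \<union> \<Union>(side \<D> \<E> {P, Q} Q) = V" using sides_Union(1)[OF ct e] V by simp
  from act_primitive[OF V(1) this assms(4) z] show ?thesis using tree_moves_edge[OF ct e] by blast
qed

section \<open>Trees with two endpoints\<close>

lemma minus_minus_fun: "- (- z) = (z :: 'a \<Rightarrow> int)"
  by (simp add: fun_eq_iff)

text \<open>\<open>u\<close> avoids the largest member strictly below \<open>C\<close>, and
  \<open>w\<close> lies in the smallest member strictly above it, or anywhere in
  \<open>X - C\<close> if there is none. Smaller members then contain neither, larger ones
  both.\<close>

lemma chain_separating_pair:
  fixes \<C> :: "'v set set"
  assumes fin: "finite \<C>" and chain: "\<And>A B. A \<in> \<C> \<Longrightarrow> B \<in> \<C> \<Longrightarrow> A \<subseteq> B \<or> B \<subseteq> A"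
    and X: "\<And>A. A \<in> \<C> \<Longrightarrow> A \<subseteq> X" and C: "C \<in> \<C>" "C \<noteq> {}" "C \<noteq> X"
  obtains u w where "u \<in> C" "w \<in> X - C" "\<And>A. A \<in> \<C> \<Longrightarrow> (u \<in> A) \<noteq> (w \<in> A) \<Longrightarrow> A = C"
proof -
  have "\<exists>u\<in>C. \<forall>A\<in>\<C>. A \<subset> C \<longrightarrow> u \<notin> A"
  proof (cases "{A \<in> \<C>. A \<subset> C} = {}")
    case False
    then obtain B where B: "B \<in> \<C>" "B \<subset> C" "\<forall>A\<in>{A \<in> \<C>. A \<subset> C}. B \<subseteq> A \<longrightarrow> B = A"
      using finite_has_maximal[of "{A \<in> \<C>. A \<subset> C}"] fin by auto
    then obtain u where "u \<in> C" "u \<notin> B" by blast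
    moreover have "A \<subseteq> B" if "A \<in> \<C>" "A \<subset> C" for A using chain[OF that(1) B(1)] B(3) that by blast
    ultimately show ?thesis by blast
  qed (use C in blast)
  then obtain u where u: "u \<in> C" "\<forall>A\<in>\<C>. A \<subset> C \<longrightarrow> u \<notin> A" by blast
  have "\<exists>w\<in>X - C. \<forall>A\<in>\<C>. C \<subset> A \<longrightarrow> w \<in> A"
  proof (cases "{A \<in> \<C>. C \<subset> A} = {}")
    case True
    then show ?thesis using C X[OF C(1)] by blast
  next
    case False
    then obtain B where B: "B \<in> \<C>" "C \<subset> B" "\<forall>A\<in>{A \<in> \<C>. C \<subset> A}. A \<subseteq> B \<longrightarrow> B = A"
      using finite_has_minimal[of "{A \<in> \<C>. C \<subset> A}"] fin by auto
    then obtain w where "w \<in> B" "w \<notin> C" by blast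
    moreover have "B \<subseteq> A" if "A \<in> \<C>" "C \<subset> A" for A using chain[OF that(1) B(1)] B(3) that by blast
    ultimately show ?thesis using X[OF B(1)] by blast
  qed
  then obtain w where w: "w \<in> X - C" "\<forall>A\<in>\<C>. C \<subset> A \<longrightarrow> w \<in> A" by blast
  have "A = C" if "A \<in> \<C>" "(u \<in> A) \<noteq> (w \<in> A)" for A
    using chain[OF that(1) C(1)] that u w by blast
  then show ?thesis using that u(1) w(1) by blast
qed

lemma swap_step_pos:
  assumes "x \<in> fiber V I \<D> b" "y \<in> fiber V I \<D> b" "y = x - swap A i i'"
    and "\<delta>\<^sub>1 \<in> A" "i \<delta>\<^sub>1 \<noteq> i' \<delta>\<^sub>1" "\<delta>\<^sub>2 \<notin> A" "i \<delta>\<^sub>2 \<noteq> i' \<delta>\<^sub>2"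
  shows "0 < x i" "0 < x i'"
proof -
  have "0 \<le> (x - swap A i i') c" for c
    using assms(2,3) by (auto simp: fiber_def tables_def)
  from this[of i] this[of i'] show "0 < x i" "0 < x i'"
    using swap_apply(1)[OF assms(4-7)] by auto
qed

text \<open>In the fiber of \<open>i + i'\<close> every marginal has mass two. Two occupied cells
  already use it up, so their restrictions must be those of \<open>i\<close> and
  \<open>i'\<close>.\<close>

lemma two_cells_restrict:
  assumes V: "finite V" and a: "a \<in> cells V I" "a' \<in> cells V I" "a \<noteq> a'"
    and i: "i \<in> cells V I" "i' \<in> cells V I"
    and t: "t \<in> fiber V I \<D> (marginal V I (\<lambda>c. of_bool (c = i) + of_bool (c = i')))"
    and pos: "0 < t a" "0 < t a'" and D: "D \<in> \<D>" "D \<subseteq> V"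
  shows "restrict a D = restrict i D \<and> restrict a' D = restrict i' D \<or>
    restrict a D = restrict i' D \<and> restrict a' D = restrict i D"
proof -
  have le: "of_bool (restrict a D = k) + of_bool (restrict a' D = k)
      \<le> of_bool (restrict i D = k) + (of_bool (restrict i' D = k) :: int)" if k: "k \<in> cells D I" for k
  proof -
    have t0: "0 \<le> t c" for c using t by (auto simp: fiber_def tables_def)
    have "of_bool (restrict a D = k) + of_bool (restrict a' D = k)
        = marginal V I (\<lambda>c. of_bool (c = a) + of_bool (c = a')) D k"
      using V a by (simp add: marginal_add marginal_of_bool)
    also have "\<dots> \<le> marginal V I t D k"
      unfolding marginal_def using pos a(3) t0 by (intro sum_mono) (auto simp: of_bool_def)
    also have "\<dots> = marginal V I (\<lambda>c. of_bool (c = i) + of_bool (c = i')) D k"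
      using t D k by (auto simp: fiber_def)
    also have "\<dots> = of_bool (restrict i D = k) + of_bool (restrict i' D = k)"
      using V i by (simp add: marginal_add marginal_of_bool)
    finally show ?thesis .
  qed
  from le[OF restrict_in_cells[OF a(1) D(2)]] le[OF restrict_in_cells[OF a(2) D(2)]]
  show ?thesis by (auto simp: of_bool_def split: if_splits)
qed

text \<open>In each coordinate where \<open>a\<close> disagrees with \<open>i\<close>, the two
  levels involved are transposed.\<close>

lemma levels_transposition:
  assumes a: "a \<in> cells V I" "a' \<in> cells V I" and i: "i \<in> cells V I" "i' \<in> cells V I"
    and pair: "\<And>\<delta>. \<delta> \<in> V \<Longrightarrow> a \<delta> = i \<delta> \<and> a' \<delta> = i' \<delta> \<or> a \<delta> = i' \<delta> \<and> a' \<delta> = i \<delta>"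
  obtains g where "g \<in> level_perms V I" "app V g a = i" "app V g a' = i'"
proof
  let ?g = "\<lambda>\<delta>. if a \<delta> = i \<delta> then id else Transposition.transpose (i \<delta>) (i' \<delta>)"
  show g: "?g \<in> level_perms V I"
    using i by (auto simp: level_perms_def cells_iff intro!: permutes_id permutes_swap_id)
  show "app V ?g a = i"
  proof (rule cells_eqI[OF app_in_cells[OF g a(1)] i(1)])
    fix \<delta> assume "\<delta> \<in> V"
    with pair[of \<delta>] show "app V ?g a \<delta> = i \<delta>"
      by (auto simp: app_def)
  qed
  show "app V ?g a' = i'"
  proof (rule cells_eqI[OF app_in_cells[OF g a(2)] i(2)])
    fix \<delta> assume "\<delta> \<in> V"
    with pair[of \<delta>] show "app V ?g a' \<delta> = i' \<delta>"
      by (auto simp: app_def)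
  qed
qed

lemma two_endpoints_minimal:
  assumes V: "finite V" "\<Union>\<D> = V" and ct: "clique_tree \<D> \<E>" and ab: "endpoints \<D> \<E> = {p, q}"
    and M': "M' \<subseteq> tree_moves V I \<D> \<E>" "G_invariant V I M'" "markov_basis V I \<D> M'"
    and z: "z \<in> tree_moves V I \<D> \<E>"
  shows "z \<in> M' \<or> - z \<in> M'"
proof (rule ccontr)
  assume nz: "\<not> (z \<in> M' \<or> - z \<in> M')"
  have tr: "tree \<D> \<E>" using ct by (simp add: clique_tree_def)
  have fin: "finite \<D>" using V finite_UnionD by blast
  have "\<E> \<subseteq> Pow \<D>" using tree_simple[OF tr] by (auto simp: simple_graph_def)
  then have fE: "finite \<E>" using fin finite_subset by blast
  \<comment> \<open>Naming sides by the two endpoints makes the sets \<open>L e\<close> a chain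
    under inclusion.\<close>
  define L where "L e = \<Union>(side \<D> \<E> e p)" for e
  define R where "R e = \<Union>(side \<D> \<E> e q)" for e
  have LR: "L e \<union> R e = V" if "e \<in> \<E>" for e
    using two_endpoints_sides(3)[OF tr fin ab that] V(2) unfolding L_def R_def by blast
  have chainL: "L e \<subseteq> L f \<or> L f \<subseteq> L e" if "e \<in> \<E>" "f \<in> \<E>" for e f
    using two_endpoints_chain[OF tr fin ab that] unfolding L_def by blast
  have movesE: "\<exists>e i i'. e \<in> \<E> \<and> i \<in> cells V I \<and> i' \<in> cells V I \<and> y = swap (L e) i i' \<and>
      (\<forall>\<delta>\<in>L e \<inter> R e. i \<delta> = i' \<delta>) \<and> (\<exists>\<delta>\<in>L e - R e. i \<delta> \<noteq> i' \<delta>) \<and> (\<exists>\<delta>\<in>R e - L e. i \<delta> \<noteq> i' \<delta>)"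
    if "y \<in> tree_moves V I \<D> \<E>" for y
  proof -
    obtain e where e: "e \<in> \<E>" "y \<in> primitive_moves V I (Union ` components \<D> (\<E> - {e}))"
      using \<open>y \<in> tree_moves V I \<D> \<E>\<close> by (auto simp: tree_moves_def)
    then have "y \<in> primitive_moves V I {L e, R e}"
      using two_endpoints_sides(1)[OF tr fin ab e(1)] by (simp add: L_def R_def)
    then show ?thesis using primitive_moves_iff[OF V(1) LR[OF e(1)]] e(1) by blast
  qed
  obtain e i i' where e: "e \<in> \<E>" and i: "i \<in> cells V I" "i' \<in> cells V I" and z_eq: "z = swap (L e) i i'"
    and eq: "\<forall>\<delta>\<in>L e \<inter> R e. i \<delta> = i' \<delta>" and d1: "\<exists>\<delta>\<in>L e - R e. i \<delta> \<noteq> i' \<delta>"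
    and d2: "\<exists>\<delta>\<in>R e - L e. i \<delta> \<noteq> i' \<delta>"
    using movesE[OF z] by blast
  define X where "X = {\<delta> \<in> V. i \<delta> \<noteq> i' \<delta>}"
  \<comment> \<open>Moves in the fiber of \<open>i + i'\<close> exchange cells that differ on all of
    \<open>X\<close>, so only edges whose overlap avoids \<open>X\<close> can occur there.
    \<open>\<C>\<close> collects the ways in which such edges cut \<open>X\<close>.\<close>
  define \<C> where "\<C> = (\<lambda>f. X \<inter> L f) ` {f \<in> \<E>. X \<inter> L f \<inter> R f = {}}"
  have C1: "finite \<C>" using fE by (simp add: \<C>_def)
  have C2: "A \<subseteq> B \<or> B \<subseteq> A" if AB: "A \<in> \<C>" "B \<in> \<C>" for A B
  proof -
    obtain f h where "f \<in> \<E>" "h \<in> \<E>" "A = X \<inter> L f" "B = X \<inter> L h" using AB unfolding \<C>_def by blast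
    then show ?thesis using chainL[of f h] by blast
  qed
  have C3: "A \<subseteq> X" if "A \<in> \<C>" for A using that unfolding \<C>_def by blast
  have C4: "X \<inter> L e \<in> \<C>" using e eq unfolding \<C>_def X_def by blast
  have C5: "X \<inter> L e \<noteq> {}" "X \<inter> L e \<noteq> X" using d1 d2 LR[OF e] unfolding X_def by blast+
  \<comment> \<open>Among these cuts, only that of \<open>e\<close> separates \<open>u\<close> from
    \<open>w\<close>.\<close>
  obtain u w where u: "u \<in> X \<inter> L e" and w: "w \<in> X - X \<inter> L e"
    and sep: "\<And>A. A \<in> \<C> \<Longrightarrow> (u \<in> A) \<noteq> (w \<in> A) \<Longrightarrow> A = X \<inter> L e"
    using chain_separating_pair[OF C1 C2 C3 C4 C5] by metis
  have uw: "i u \<noteq> i' u" "i w \<noteq> i' w" "u \<in> L e" "w \<notin> L e" "u \<in> X" "w \<in> X"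
    using u w by (auto simp: X_def)
  \<comment> \<open>\<open>x\<close> is the smallest table from which \<open>z\<close> can be
    subtracted; \<open>x - z\<close> is another table of its fiber.\<close>
  define x where "x = (\<lambda>c. of_bool (c = i) + (of_bool (c = i') :: int))"
  define F where "F = fiber V I \<D> (marginal V I x)"
  define j where "j = mix (L e) i i'"
  have xF: "x \<in> F" using i by (auto simp: F_def fiber_def x_def tables_def arrays_def)
  have ii: "i \<noteq> i'" using uw by auto
  have zm: "z \<in> moves V I \<D>" using tree_moves_subset_moves[OF V ct] z by blast
  have yF: "x - z \<in> F" using fiber_minus_swap[OF V(1) xF[unfolded F_def], of "L e" i i'] zm ii
    unfolding F_def z_eq by (simp add: x_def)
  \<comment> \<open>The pairing of levels at \<open>u\<close> and \<open>w\<close> survives every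
    step in \<open>M'\<close>; otherwise the move used would lie in the orbit of \<open>z\<close> up
    to sign.\<close>
  have inv: "t \<in> F \<and> (\<forall>c. t c \<noteq> 0 \<longrightarrow> (c u = i u \<longleftrightarrow> c w = i w))"
    if "(fiber_step V I \<D> (marginal V I x) M')\<^sup>*\<^sup>* x t" for t
    using that
  proof (induction rule: rtranclp_induct)
    case base
    show ?case using xF uw by (auto simp: x_def)
  next
    case (step t t')
    have t: "t \<in> F" and inv: "\<And>c. t c \<noteq> 0 \<Longrightarrow> (c u = i u \<longleftrightarrow> c w = i w)" using step.IH by auto
    obtain z' where t': "t' \<in> F" and z': "z' \<in> M'" "t' - t = z' \<or> t' - t = - z'"
      using step(2) by (auto simp: fiber_step_def F_def)
    obtain f k k' where f: "f \<in> \<E>" and k: "k \<in> cells V I" "k' \<in> cells V I" "z' = swap (L f) k k'"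
      and k_eq: "\<forall>\<delta>\<in>L f \<inter> R f. k \<delta> = k' \<delta>" and k1: "\<exists>\<delta>\<in>L f - R f. k \<delta> \<noteq> k' \<delta>"
      and k2: "\<exists>\<delta>\<in>R f - L f. k \<delta> \<noteq> k' \<delta>"
      using movesE[of z'] z'(1) M'(1) by blast
    \<comment> \<open>Whatever the sign, the step is written as subtracting a swap, so that its
      positive cells \<open>a\<close> and \<open>a'\<close> are occupied in
      \<open>t\<close>.\<close>
    have "\<exists>a a'. a \<in> cells V I \<and> a' \<in> cells V I \<and> t' - t = - swap (L f) a a' \<and>
        (z' = swap (L f) a a' \<or> z' = - swap (L f) a a') \<and> (\<forall>\<delta>. a \<delta> = a' \<delta> \<longleftrightarrow> k \<delta> = k' \<delta>)"
    proof (cases "t' - t = - z'")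
      case True
      then show ?thesis using k by blast
    next
      case False
      then have "t' - t = z'" using z'(2) by simp
      moreover have "z' = - swap (L f) (mix (L f) k k') (mix (L f) k' k)"
        unfolding uminus_swap mix_mix by (rule k(3))
      moreover have "mix (L f) k k' \<in> cells V I" "mix (L f) k' k \<in> cells V I"
        using k by (auto intro: mix_in_cells)
      moreover have "\<forall>\<delta>. mix (L f) k k' \<delta> = mix (L f) k' k \<delta> \<longleftrightarrow> k \<delta> = k' \<delta>"
        by (auto simp: mix_def)
      ultimately show ?thesis by blast
    qed
    then obtain a a' where a: "a \<in> cells V I" "a' \<in> cells V I" "t' - t = - swap (L f) a a'"
      and z'a: "z' = swap (L f) a a' \<or> z' = - swap (L f) a a'"
      and ak: "\<forall>\<delta>. a \<delta> = a' \<delta> \<longleftrightarrow> k \<delta> = k' \<delta>"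
      by blast
    then have a_eq: "\<forall>\<delta>\<in>L f \<inter> R f. a \<delta> = a' \<delta>"
      and "\<exists>\<delta>\<in>L f. a \<delta> \<noteq> a' \<delta>" "\<exists>\<delta>\<in>- L f. a \<delta> \<noteq> a' \<delta>"
      using k_eq k1 k2 by auto
    then obtain d d' where d: "d \<in> L f" "a d \<noteq> a' d" "d' \<notin> L f" "a d' \<noteq> a' d'" by blast
    have t'_eq: "t' = t - swap (L f) a a'" using a(3) by (simp add: fun_eq_iff algebra_simps)
    have pos: "0 < t a" "0 < t a'"
      using swap_step_pos[OF t[unfolded F_def] t'[unfolded F_def] t'_eq d] by auto
    have "a \<noteq> a'" using d by auto
    have pair: "a \<delta> = i \<delta> \<and> a' \<delta> = i' \<delta> \<or> a \<delta> = i' \<delta> \<and> a' \<delta> = i \<delta>" if "\<delta> \<in> V" for \<delta>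
    proof -
      obtain D where D: "D \<in> \<D>" "\<delta> \<in> D" using V(2) \<open>\<delta> \<in> V\<close> by blast
      then have "D \<subseteq> V" using V(2) by blast
      from two_cells_restrict[OF V(1) a(1,2) \<open>a \<noteq> a'\<close> i t[unfolded F_def x_def] pos D(1) this]
      show ?thesis using D(2) by (auto simp: restrict_eq_iff)
    qed
    have "c u = i u \<longleftrightarrow> c w = i w" if "t' c \<noteq> 0" for c
    proof (rule ccontr)
      assume c: "\<not> (c u = i u \<longleftrightarrow> c w = i w)"
      then have "t c = 0" using inv by blast
      then have "swap (L f) a a' c \<noteq> 0" "c \<noteq> a" "c \<noteq> a'" using that t'_eq pos by auto
      then have c': "c = mix (L f) a a' \<or> c = mix (L f) a' a"
        using swap_apply(1)[OF d, of c] by (auto split: if_splits)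
      have "a u = i u \<longleftrightarrow> a w = i w" "a' u = i u \<longleftrightarrow> a' w = i w" using inv pos by auto
      \<comment> \<open>Both \<open>a\<close> and \<open>a'\<close> respect the pairing, so a
        mixture violates it only when \<open>u\<close> and \<open>w\<close> are taken from different
        cells.\<close>
      then have uwf: "(u \<in> L f) \<noteq> (w \<in> L f)" using c c' by (auto simp: mix_def split: if_splits)
      have "X \<inter> L f \<inter> R f = {}"
      proof (rule ccontr)
        assume "X \<inter> L f \<inter> R f \<noteq> {}"
        then obtain \<delta> where \<delta>: "\<delta> \<in> V" "i \<delta> \<noteq> i' \<delta>" "\<delta> \<in> L f \<inter> R f" by (auto simp: X_def)
        then show False using pair[OF \<delta>(1)] a_eq by auto
      qed
      then have "X \<inter> L f \<in> \<C>" using f by (auto simp: \<C>_def)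
      then have XL: "X \<inter> L f = X \<inter> L e" using sep[of "X \<inter> L f"] uwf uw by blast
      have "\<delta> \<in> L f \<longleftrightarrow> \<delta> \<in> L e" if "a \<delta> \<noteq> a' \<delta>" for \<delta>
      proof -
        have "\<delta> \<in> V" using that a(1,2) unfolding cells_iff by metis
        then have "\<delta> \<in> X" using pair[of \<delta>] that by (auto simp: X_def)
        then show ?thesis using XL by blast
      qed
      then have sw: "swap (L f) a a' = swap (L e) a a'" by (rule swap_cong)
      \<comment> \<open>Since \<open>f\<close> cuts \<open>X\<close> as \<open>e\<close> does, a
        level permutation carries the move onto \<open>z\<close> up to sign, and invariance of
        \<open>M'\<close> would put \<open>z\<close> or \<open>-z\<close> into
        \<open>M'\<close>.\<close>
      obtain g where g: "g \<in> level_perms V I" "app V g a = i" "app V g a' = i'"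
        using levels_transposition[OF a(1,2) i pair] by blast
      have "act V I g (swap (L f) a a') = z"
        unfolding sw z_eq act_swap[OF g(1) a(1,2)] g by simp
      then have "act V I g z' = z \<or> act V I g z' = - z" using z'a act_uminus by metis
      moreover have "act V I g z' \<in> M' \<or> - act V I g z' \<in> M'"
        using M'(2) g(1) z'(1) by (auto simp: G_invariant_def)
      ultimately show False using nz by (auto simp: minus_minus_fun)
    qed
    then show ?case using t' by blast
  qed
  have "(fiber_step V I \<D> (marginal V I x) M')\<^sup>*\<^sup>* x (x - z)"
    using M'(3) xF yF unfolding markov_basis_iff F_def by blast
  then have "\<forall>c. (x - z) c \<noteq> 0 \<longrightarrow> (c u = i u \<longleftrightarrow> c w = i w)" using inv by blast
  \<comment> \<open>The cell \<open>j\<close> created by subtracting \<open>z\<close> has the level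
    of \<open>i'\<close> at \<open>u\<close> and that of \<open>i\<close> at \<open>w\<close>, which
    breaks the pairing.\<close>
  moreover have "(x - z) j \<noteq> 0"
    unfolding x_def z_eq j_def by (simp add: swap_def of_bool_def)
  moreover have "j u = i' u" "j w = i w" using uw by (auto simp: j_def mix_def)
  ultimately show False using uw by metis
qed

section \<open>Trees with three endpoints\<close>

text \<open>By the antichain property a leaf has a vertex outside its only neighbour. Any other
  clique with that vertex would lie beyond the edge, and the vertex would belong to the
  separator.\<close>

lemma endpoint_private_vertex:
  assumes ct: "clique_tree \<D> \<E>" and a: "a \<in> endpoints \<D> \<E>"
    and anti: "\<forall>C\<in>\<D>. \<forall>D\<in>\<D>. C \<subseteq> D \<longrightarrow> C = D"
  obtains v Q where "v \<in> a" "\<forall>D\<in>\<D>. v \<in> D \<longrightarrow> D = a" "{a, Q} \<in> \<E>" "side \<D> \<E> {a, Q} a = {a}"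
proof -
  have tr: "tree \<D> \<E>" using ct by (simp add: clique_tree_def)
  obtain Q where e: "{a, Q} \<in> \<E>" and sa: "side \<D> \<E> {a, Q} a = {a}"
    by (rule endpoint_edge[OF tr a])
  note aQ = simple_graph_edge[OF tree_simple[OF tr] e]
  obtain v where v: "v \<in> a" "v \<notin> Q" using anti aQ by blast
  have "D = a" if D: "D \<in> \<D>" "v \<in> D" for D
  proof (rule ccontr)
    assume "D \<noteq> a"
    then have "D \<in> side \<D> \<E> {a, Q} Q" using sides_cover[OF tr e] sa D(1) by blast
    then have "v \<in> a \<inter> Q" using clique_tree_separator[OF ct e] sa v(1) D(2) by blast
    then show False using v(2) by blast
  qed
  then show ?thesis using that v(1) e sa by blast
qed

text \<open>One side of the leaf edge is \<open>a\<close> alone. If the cells differ in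
  \<open>a\<close> only at the private vertex, exchanging the coordinates in \<open>a\<close>
  amounts to exchanging that single one; \<open>\<delta>'\<close> makes the move nonzero.\<close>

lemma leaf_swap:
  assumes V: "finite V" "\<Union>\<D> = V" and ct: "clique_tree \<D> \<E>"
    and v: "v \<in> a" "\<forall>D\<in>\<D>. v \<in> D \<longrightarrow> D = a" and e: "{a, Q} \<in> \<E>" "side \<D> \<E> {a, Q} a = {a}"
    and i: "i \<in> cells V I" "i' \<in> cells V I" and iv: "i v \<noteq> i' v"
    and on_a: "\<And>\<delta>. \<delta> \<in> a \<Longrightarrow> i \<delta> \<noteq> i' \<delta> \<Longrightarrow> \<delta> = v" and off_a: "\<delta>' \<notin> a" "i \<delta>' \<noteq> i' \<delta>'"
  shows "swap {v} i i' \<in> tree_moves V I \<D> \<E>"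
proof -
  let ?B = "\<Union>(side \<D> \<E> {a, Q} Q)"
  have tr: "tree \<D> \<E>" using ct by (simp add: clique_tree_def)
  have "v \<notin> ?B" using sides_disjoint[OF tr e(1)] e(2) v(2) side_subset[of \<D> \<E> "{a, Q}" Q] by auto
  moreover have "\<delta>' \<in> V" using off_a(2) i unfolding cells_iff by metis
  then have "\<delta>' \<in> ?B" using sides_Union(1)[OF ct e(1)] e(2) V(2) off_a(1) by auto
  moreover have "\<forall>\<delta>\<in>a \<inter> ?B. i \<delta> = i' \<delta>" using on_a \<open>v \<notin> ?B\<close> by blast
  ultimately have "swap a i i' \<in> primitive_moves V I {a, ?B}"
    using swap_primitive[OF V(1) i, of a ?B v \<delta>'] v(1) iv off_a by blast
  moreover have "swap a i i' = swap {v} i i'"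
    using on_a v(1) by (intro swap_cong) blast
  ultimately show ?thesis using tree_moves_edge[OF ct e(1), of V I] e(2) by auto
qed

text \<open>The moves to be discarded. They are described by the coordinates in which the cells
  differ, which level permutations preserve.\<close>

definition singleton_swaps :: "'v set \<Rightarrow> ('v \<Rightarrow> nat) \<Rightarrow> 'v \<Rightarrow> 'v set \<Rightarrow> (('v \<Rightarrow> nat) \<Rightarrow> int) set" where
  "singleton_swaps V I v X = {swap {v} i i' |i i'. i \<in> cells V I \<and> i' \<in> cells V I \<and> {\<delta>. i \<delta> \<noteq> i' \<delta>} = X}"

lemma uminus_singleton_swaps: "z \<in> singleton_swaps V I v X \<Longrightarrow> - z \<in> singleton_swaps V I v X"
proof -
  assume "z \<in> singleton_swaps V I v X"
  then obtain i i' where i: "i \<in> cells V I" "i' \<in> cells V I" "{\<delta>. i \<delta> \<noteq> i' \<delta>} = X" "z = swap {v} i i'"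
    by (auto simp: singleton_swaps_def)
  have "{\<delta>. mix {v} i i' \<delta> \<noteq> mix {v} i' i \<delta>} = X" unfolding i(3)[symmetric] by (auto simp: mix_def)
  then show ?thesis unfolding singleton_swaps_def i(4) uminus_swap
    using mix_in_cells[OF i(1,2)] mix_in_cells[OF i(2,1)] by blast
qed

lemma act_singleton_swaps:
  assumes g: "g \<in> level_perms V I" and z: "z \<in> singleton_swaps V I v X"
  shows "act V I g z \<in> singleton_swaps V I v X"
proof -
  obtain i i' where i: "i \<in> cells V I" "i' \<in> cells V I" "{\<delta>. i \<delta> \<noteq> i' \<delta>} = X" "z = swap {v} i i'"
    using z by (auto simp: singleton_swaps_def)
  have "app V g i \<delta> = app V g i' \<delta> \<longleftrightarrow> i \<delta> = i' \<delta>" for \<delta>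
    using app_eq_iff[OF g] i(1,2) by (cases "\<delta> \<in> V") (auto simp: app_def cells_iff)
  then have "{\<delta>. app V g i \<delta> \<noteq> app V g i' \<delta>} = X" using i(3) by simp
  then show ?thesis unfolding singleton_swaps_def i(4) act_swap[OF g i(1,2)]
    using app_in_cells[OF g i(1)] app_in_cells[OF g i(2)] by blast
qed

text \<open>Serves the invariance of a set difference: if an image fell into the removed set,
  undoing the permutation would put the original there too.\<close>

lemma act_inverse:
  assumes g: "g \<in> level_perms V I" and z: "z \<in> arrays V I"
  shows "act V I (\<lambda>\<delta>. inv (g \<delta>)) (act V I g z) = z" and "(\<lambda>\<delta>. inv (g \<delta>)) \<in> level_perms V I"
proof -
  have p: "g \<delta> permutes {0..<I \<delta>}" if "\<delta> \<in> V" for \<delta> using g that by (simp add: level_perms_def)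
  show h: "(\<lambda>\<delta>. inv (g \<delta>)) \<in> level_perms V I"
    using p by (auto simp: level_perms_def intro: permutes_inv)
  have inv2: "inv (g \<delta>) (inv (inv (g \<delta>)) x) = x" if "\<delta> \<in> V" for \<delta> x
    using p[OF that] by (metis permutes_inv permutes_inverses(1))
  have "(\<lambda>\<delta>\<in>V. inv (inv (g \<delta>)) (c \<delta>)) \<in> cells V I" if "c \<in> cells V I" for c
    using that permutes_in_image[OF permutes_inv[OF permutes_inv[OF p]]]
    by (auto simp: cells_iff)
  moreover have "(\<lambda>\<delta>\<in>V. inv (g \<delta>) ((\<lambda>\<delta>\<in>V. inv (inv (g \<delta>)) (c \<delta>)) \<delta>)) = c" if "c \<in> cells V I" for c
    using that inv2 by (auto simp: fun_eq_iff cells_iff)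
  ultimately have "act V I (\<lambda>\<delta>. inv (g \<delta>)) (act V I g z) c = z c" for c
    using z by (cases "c \<in> cells V I") (simp_all add: act_def arrays_def)
  then show "act V I (\<lambda>\<delta>. inv (g \<delta>)) (act V I g z) = z" by blast
qed

text \<open>Equal swaps have the same positive cells, so the negative ones can be compared. The
  third coordinate \<open>v'\<close> tells them apart: for cells differing at \<open>v\<close> and
  \<open>v1\<close> only, the swaps at these two coordinates coincide.\<close>

lemma swap_not_in_singleton_swaps:
  assumes j: "{\<delta>. j \<delta> \<noteq> j' \<delta>} = X" and v: "v \<in> X" "v1 \<in> X" "v \<noteq> v1" "v' \<in> X" "v' \<noteq> v" "v' \<noteq> v1"
  shows "swap {v} j j' \<notin> singleton_swaps V I v1 X"
proof
  assume "swap {v} j j' \<in> singleton_swaps V I v1 X"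
  then obtain i i' where i: "{\<delta>. i \<delta> \<noteq> i' \<delta>} = X" and s: "swap {v} j j' = swap {v1} i i'"
    by (auto simp: singleton_swaps_def)
  have jn: "j v \<noteq> j' v" "j v1 \<noteq> j' v1" "j v' \<noteq> j' v'" and iN: "i v1 \<noteq> i' v1" "i v \<noteq> i' v"
    using i j v by auto
  have vn: "v \<in> {v}" "v1 \<notin> {v}" "v1 \<in> {v1}" "v \<notin> {v1}" using v by auto
  note sj = swap_apply[OF vn(1) jn(1) vn(2) jn(2)] and si = swap_apply[OF vn(3) iN(1) vn(4) iN(2)]
  have "j \<in> {i, i'}" "j' \<in> {i, i'}"
    using sj(1)[of j] sj(1)[of j'] si(1)[of j] si(1)[of j'] s by (auto split: if_splits)
  moreover have "j \<noteq> j'" using jn by auto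
  ultimately have "swap {v1} i i' = swap {v1} j j'" using swap_commute by (metis insertE singletonD)
  moreover have "swap {v} j j' (mix {v} j j') < 0"
    using sj(1,2) by auto
  ultimately have "swap {v1} j j' (mix {v} j j') < 0" using s by simp
  then have "mix {v} j j' = mix {v1} j j' \<or> mix {v} j j' = mix {v1} j' j"
    using swap_apply(1)[OF vn(3) jn(2) vn(4) jn(1)] by (auto split: if_splits)
  moreover have "mix {v} j j' v \<noteq> mix {v1} j j' v" using jn v by (simp add: mix_def)
  moreover have "mix {v} j j' v' \<noteq> mix {v1} j' j v'" using jn v by (simp add: mix_def)
  ultimately show False by metis
qed

lemma three_endpoints_not_minimal:
  assumes V: "finite V" "\<Union>\<D> = V" and I: "\<forall>\<delta>\<in>V. 2 \<le> I \<delta>" and ct: "clique_tree \<D> \<E>"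
    and anti: "\<forall>C\<in>\<D>. \<forall>D\<in>\<D>. C \<subseteq> D \<longrightarrow> C = D"
    and a: "a1 \<in> endpoints \<D> \<E>" "a2 \<in> endpoints \<D> \<E>" "a3 \<in> endpoints \<D> \<E>"
    and ne: "a1 \<noteq> a2" "a1 \<noteq> a3" "a2 \<noteq> a3"
  shows "\<exists>M'. proper_subset_upto_sign M' (tree_moves V I \<D> \<E>) \<and> G_invariant V I M' \<and> markov_basis V I \<D> M'"
proof -
  let ?M = "tree_moves V I \<D> \<E>"
  have aD: "a1 \<in> \<D>" "a2 \<in> \<D>" "a3 \<in> \<D>" using a by (auto simp: endpoints_def)
  obtain v1 Q1 where v1: "v1 \<in> a1" "\<forall>D\<in>\<D>. v1 \<in> D \<longrightarrow> D = a1"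
    "{a1, Q1} \<in> \<E>" "side \<D> \<E> {a1, Q1} a1 = {a1}"
    by (rule endpoint_private_vertex[OF ct a(1) anti])
  obtain v2 Q2 where v2: "v2 \<in> a2" "\<forall>D\<in>\<D>. v2 \<in> D \<longrightarrow> D = a2"
    "{a2, Q2} \<in> \<E>" "side \<D> \<E> {a2, Q2} a2 = {a2}"
    by (rule endpoint_private_vertex[OF ct a(2) anti])
  obtain v3 Q3 where v3: "v3 \<in> a3" "\<forall>D\<in>\<D>. v3 \<in> D \<longrightarrow> D = a3"
    "{a3, Q3} \<in> \<E>" "side \<D> \<E> {a3, Q3} a3 = {a3}"
    by (rule endpoint_private_vertex[OF ct a(3) anti])
  have off: "v2 \<notin> a1" "v3 \<notin> a1" "v1 \<notin> a2" "v3 \<notin> a2" "v1 \<notin> a3" "v2 \<notin> a3"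
    using v1(2) v2(2) v3(2) aD ne by blast+
  have vne: "v1 \<noteq> v2" "v1 \<noteq> v3" "v2 \<noteq> v3" using off v1(1) v2(1) by blast+
  have vV: "v1 \<in> V" "v2 \<in> V" "v3 \<in> V" using v1(1) v2(1) v3(1) aD V(2) by blast+
  define X where "X = {v1, v2, v3}"
  have leaf: "swap {v1} i i' \<in> ?M" "swap {v2} i i' \<in> ?M" "swap {v3} i i' \<in> ?M"
    if i: "i \<in> cells V I" "i' \<in> cells V I" "{\<delta>. i \<delta> \<noteq> i' \<delta>} = X" for i i'
  proof -
    have d: "i \<delta> \<noteq> i' \<delta> \<longleftrightarrow> \<delta> = v1 \<or> \<delta> = v2 \<or> \<delta> = v3" for \<delta> using i(3) unfolding X_def by blast
    show "swap {v1} i i' \<in> ?M"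
      using d off by (intro leaf_swap[OF V ct v1 i(1,2), of v2]) auto
    show "swap {v2} i i' \<in> ?M"
      using d off by (intro leaf_swap[OF V ct v2 i(1,2), of v1]) auto
    show "swap {v3} i i' \<in> ?M"
      using d off by (intro leaf_swap[OF V ct v3 i(1,2), of v1]) auto
  qed
  let ?N = "singleton_swaps V I v1 X"
  let ?M' = "?M - ?N"
  have "proper_subset_upto_sign ?M' ?M"
  proof -
    \<comment> \<open>Two levels per variable suffice for a pair of cells differing exactly on
      \<open>X\<close>, so something is really removed.\<close>
    define i where "i = (\<lambda>\<delta>\<in>V. 0 :: nat)"
    define i' where "i' = (\<lambda>\<delta>\<in>V. if \<delta> \<in> X then 1 else 0 :: nat)"
    have "i \<in> cells V I" "i' \<in> cells V I"
      using I by (fastforce simp: cells_iff i_def i'_def)+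
    moreover have "{\<delta>. i \<delta> \<noteq> i' \<delta>} = X"
      using vV by (auto simp: i_def i'_def X_def restrict_def)
    ultimately have M: "swap {v1} i i' \<in> ?M" and N: "swap {v1} i i' \<in> ?N"
      using leaf(1)[of i i'] unfolding singleton_swaps_def by (simp, blast)
    show ?thesis
      unfolding proper_subset_upto_sign_def
    proof (intro conjI bexI[OF _ M])
      show "swap {v1} i i' \<notin> ?M'" "- swap {v1} i i' \<notin> ?M'"
        using N uminus_singleton_swaps[OF N] by simp_all
    qed simp
  qed
  moreover have "G_invariant V I ?M'"
    unfolding G_invariant_def
  proof (intro ballI disjI1)
    fix g z assume g: "g \<in> level_perms V I" and z: "z \<in> ?M'"
    have "z \<in> arrays V I" using z tree_moves_subset_moves[OF V ct] by (auto simp: moves_def)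
    note inv = act_inverse[OF g this]
    have "act V I g z \<notin> ?N"
      using act_singleton_swaps[OF inv(2), of "act V I g z" v1 X] inv(1) z by auto
    then show "act V I g z \<in> ?M'" using act_tree_moves[OF V ct g] z by blast
  qed
  moreover have "markov_basis V I \<D> ?M'"
  proof -
    have sub: "?M \<subseteq> moves V I \<D>" by (rule tree_moves_subset_moves[OF V ct])
    have step: "(fiber_step V I \<D> b ?M')\<^sup>*\<^sup>* x y" if xy: "fiber_step V I \<D> b ?M x y" for b x y
    proof -
      obtain z where x: "x \<in> fiber V I \<D> b" and y: "y \<in> fiber V I \<D> b"
        and z: "z \<in> ?M" "y - x = z \<or> y - x = - z" using xy by (auto simp: fiber_step_def)
      show ?thesis
      proof (cases "z \<in> ?N")
        case False
        then have "fiber_step V I \<D> b ?M' x y" using x y z by (auto simp: fiber_step_def)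
        then show ?thesis by blast
      next
        case True
        \<comment> \<open>The removed set is closed under sign, so the step can be taken as a
          subtraction with \<open>j\<close> and \<open>j'\<close> occupied in
          \<open>x\<close>.\<close>
        then have "- (y - x) \<in> ?N" using z(2) uminus_singleton_swaps by (metis minus_minus_fun)
        then obtain j j' where j: "j \<in> cells V I" "j' \<in> cells V I" "{\<delta>. j \<delta> \<noteq> j' \<delta>} = X"
          and jz: "- (y - x) = swap {v1} j j'" by (auto simp: singleton_swaps_def)
        have d: "j \<delta> \<noteq> j' \<delta> \<longleftrightarrow> \<delta> = v1 \<or> \<delta> = v2 \<or> \<delta> = v3" for \<delta> using j(3) unfolding X_def by blast
        have y_eq: "y = x - swap {v1} j j'"
        proof
          fix c
          show "y c = (x - swap {v1} j j') c" using fun_cong[OF jz, of c] by simp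
        qed
        have pos: "0 < x j" "0 < x j'"
          using swap_step_pos[OF x y y_eq, of v1 v2] d vne by auto
        define k where "k = mix {v2} j j'"
        define k' where "k' = mix {v2} j' j"
        have k: "k \<in> cells V I" "k' \<in> cells V I" using j by (auto simp: k_def k'_def mix_in_cells)
        have kX: "{\<delta>. k \<delta> \<noteq> k' \<delta>} = X" unfolding j(3)[symmetric] by (auto simp: k_def k'_def mix_def)
        define t where "t = x - swap {v2} j j'"
        have "j \<noteq> j'" using d[of v1] by auto
        then have t: "t \<in> fiber V I \<D> b"
          unfolding t_def using fiber_minus_swap[OF V(1) x _ _ pos] leaf(2)[OF j] sub by blast
        \<comment> \<open>After the exchange at \<open>v2\<close>, a further one at
          \<open>v3\<close> amounts to an exchange at \<open>v1\<close> with the two cells in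
          reversed roles, since they differ nowhere else.\<close>
        have kj: "mix {v3} k k' = mix {v1} j' j" "mix {v3} k' k = mix {v1} j j'"
        proof -
          have "mix {v3} k k' \<delta> = mix {v1} j' j \<delta> \<and> mix {v3} k' k \<delta> = mix {v1} j j' \<delta>" for \<delta>
            using d[of \<delta>] vne by (cases "\<delta> = v1"; cases "\<delta> = v2"; cases "\<delta> = v3")
              (simp_all add: k_def k'_def mix_def)
          then show "mix {v3} k k' = mix {v1} j' j" "mix {v3} k' k = mix {v1} j j'" by blast+
        qed
        \<comment> \<open>The cells created by the first swap are consumed by the second, so their
          indicators cancel.\<close>
        have "swap {v1} j j' c = swap {v2} j j' c + swap {v3} k k' c" for c
          unfolding swap_def kj by (simp add: k_def k'_def)
        then have "y = t - swap {v3} k k'" unfolding y_eq t_def by (simp add: fun_eq_iff)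
        then have s2: "y - t = - swap {v3} k k'" by (simp add: fun_eq_iff)
        have s1: "t - x = - swap {v2} j j'" by (simp add: t_def fun_eq_iff)
        have "swap {v2} j j' \<in> ?M'"
          using leaf(2)[OF j] swap_not_in_singleton_swaps[OF j(3), of v2 v1 v3] vne by (auto simp: X_def)
        then have "fiber_step V I \<D> b ?M' x t" using x t s1 by (auto simp: fiber_step_def)
        moreover have "swap {v3} k k' \<in> ?M'"
          using leaf(3)[OF k kX] swap_not_in_singleton_swaps[OF kX, of v3 v1 v2] vne by (auto simp: X_def)
        then have "fiber_step V I \<D> b ?M' t y" using y t s2 by (auto simp: fiber_step_def)
        ultimately show ?thesis by auto
      qed
    qed
    have "(fiber_step V I \<D> b ?M')\<^sup>*\<^sup>* x y" if "(fiber_step V I \<D> b ?M)\<^sup>*\<^sup>* x y" for b x y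
      using that by (induction rule: rtranclp_induct) (auto dest: step intro: rtranclp_trans)
    then show ?thesis
      using tree_moves_markov_basis[OF V ct] unfolding markov_basis_iff by blast
  qed
  ultimately show ?thesis by blast
qed

theorem theorem7:
  fixes m :: nat and I :: "nat \<Rightarrow> nat" and \<D> :: "nat set set" and \<E> :: "nat set set set"
  assumes "\<And>\<delta>. \<delta> \<in> {1..m} \<Longrightarrow> 2 \<le> I \<delta>"
    and "generating_class {1..m} \<D>"
    and "decomposable {1..m} \<D>"
    and "2 \<le> card \<D>"
    and "clique_tree \<D> \<E>"
  shows "minimal_G_invariant_markov_basis {1..m} I \<D> (tree_moves {1..m} I \<D> \<E>)
           \<longleftrightarrow> card (endpoints \<D> \<E>) = 2"
proof -
  let ?V = "{1..m}"
  have V: "finite ?V" "\<Union>\<D> = ?V" using assms(2) by (auto simp: generating_class_def)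
  have anti: "\<forall>C\<in>\<D>. \<forall>D\<in>\<D>. C \<subseteq> D \<longrightarrow> C = D"
    using assms(2) unfolding generating_class_def facets_def by blast
  have I: "\<forall>\<delta>\<in>?V. 2 \<le> I \<delta>" using assms(1) by blast
  have ct: "clique_tree \<D> \<E>" by fact
  have tr: "tree \<D> \<E>" using ct by (simp add: clique_tree_def)
  have fin: "finite \<D>" using V finite_UnionD by metis
  have G: "G_invariant ?V I (tree_moves ?V I \<D> \<E>)"
    unfolding G_invariant_def using act_tree_moves[OF V ct] by blast
  show ?thesis
  proof
    assume min: "minimal_G_invariant_markov_basis ?V I \<D> (tree_moves ?V I \<D> \<E>)"
    show "card (endpoints \<D> \<E>) = 2"
    proof (rule ccontr)
      assume "card (endpoints \<D> \<E>) \<noteq> 2"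
      then have "3 \<le> card (endpoints \<D> \<E>)" using two_le_card_endpoints[OF tr fin assms(4)] by simp
      then obtain S where "S \<subseteq> endpoints \<D> \<E>" "card S = 3"
        by (meson obtain_subset_with_card_n)
      then obtain a b c where "a \<in> endpoints \<D> \<E>" "b \<in> endpoints \<D> \<E>" "c \<in> endpoints \<D> \<E>"
        "a \<noteq> b" "a \<noteq> c" "b \<noteq> c" by (auto simp: card_3_iff)
      from three_endpoints_not_minimal[OF V I ct anti this] min
      show False unfolding minimal_G_invariant_markov_basis_def by blast
    qed
  next
    assume "card (endpoints \<D> \<E>) = 2"
    then obtain a b where ab: "endpoints \<D> \<E> = {a, b}" by (auto simp: card_2_iff)
    show "minimal_G_invariant_markov_basis ?V I \<D> (tree_moves ?V I \<D> \<E>)"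
      unfolding minimal_G_invariant_markov_basis_def proper_subset_upto_sign_def
      using tree_moves_markov_basis[OF V ct] G two_endpoints_minimal[OF V ct ab] by blast
  qed
qed

end
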